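(* Assume (in addition to ZFC) $\mathsf{PBP}$: every projective set of reals has the Baire property. Then for every connected manifold $M$ there exist $g,h\in\mathrm{Homeo}(M)$ such that $\mathrm{tp}(g)=\mathrm{tp}(h)$ but $g$ and $h$ are not conjugate in $\mathrm{Homeo}(M)$.
   Context: Conventions: a manifold is a connected, second countable, Hausdorff topological manifold of positive finite dimension with empty boundary, not necessarily compact. $\mathrm{Homeo}(M)$ is the group of all homeomorphisms of $M$, viewed as a first-order structure in the language $\mathcal L$ of group theory (binary multiplication and identity). For $g\in\mathrm{Homeo}(M)$, the type $\mathrm{tp}(g)$ is the set of all first-order $\mathcal L$-formulae $\psi(v)$ in one free variable (without parameters) such that $\mathrm{Homeo}(M)\models\psi(g)$. A subset of a topological space has the Baire property if its symmetric difference with some open set is meager. Projective sets are those in the (boldface) projective hierarchy. *)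

theory Defs
  imports "HOL-Analysis.Analysis" "HOL-Algebra.Bij"
begin

section \<open>Manifolds and their homeomorphism groups\<close>

text \<open>
  The empty space is \<open>connected_space\<close> and vacuously locally Euclidean, but it is not a
  manifold of positive dimension; hence the explicit nonemptiness condition.  Emptiness of the
  boundary is part of the charts being onto open subsets of the full Euclidean space.
\<close>

definition manifold :: "'a topology \<Rightarrow> bool" where
  "manifold M \<longleftrightarrow>
     topspace M \<noteq> {} \<and> connected_space M \<and> second_countable M \<and> Hausdorff_space M \<and>
     (\<exists>n>0. \<forall>x\<in>topspace M. \<exists>U V. openin M U \<and> x \<in> U \<and> openin (Euclidean_space n) V \<and>
        subtopology M U homeomorphic_space subtopology (Euclidean_space n) V)"

text \<open>
  As in \<^const>\<open>BijGroup\<close>, a homeomorphism is represented by the unique function that agrees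
  with it on \<open>topspace M\<close> and is \<open>undefined\<close> elsewhere.
\<close>

definition Homeo :: "'a topology \<Rightarrow> ('a \<Rightarrow> 'a) monoid" where
  "Homeo M = BijGroup (topspace M)
     \<lparr>carrier := {f \<in> extensional (topspace M). homeomorphic_map M M f}\<rparr>"

definition conjugate_in :: "('g, 'm) monoid_scheme \<Rightarrow> 'g \<Rightarrow> 'g \<Rightarrow> bool" where
  "conjugate_in G g h \<longleftrightarrow> (\<exists>k\<in>carrier G. h = k \<otimes>\<^bsub>G\<^esub> g \<otimes>\<^bsub>G\<^esub> inv\<^bsub>G\<^esub> k)"

lemma Homeo_subset_Bij: "carrier (Homeo M) \<subseteq> Bij (topspace M)"
  by (auto simp: Homeo_def Bij_def bij_betw_def homeomorphic_eq_everything_map)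

lemma subgroup_Homeo: "subgroup (carrier (Homeo M)) (BijGroup (topspace M))"
proof -
  let ?S = "topspace M"
  interpret B: group "BijGroup ?S" by (rule group_BijGroup)
  have car: "f \<in> carrier (Homeo M) \<longleftrightarrow> f \<in> extensional ?S \<and> homeomorphic_map M M f" for f
    by (simp add: Homeo_def)
  show ?thesis
  proof (rule B.subgroupI)
    show "carrier (Homeo M) \<subseteq> carrier (BijGroup ?S)"
      using Homeo_subset_Bij by (auto simp: BijGroup_def)
    have "homeomorphic_map M M (\<lambda>x\<in>?S. x)"
      by (rule homeomorphic_map_eq [of _ _ id]) auto
    then show "carrier (Homeo M) \<noteq> {}"
      using car by blast
  next
    fix f assume f: "f \<in> carrier (Homeo M)"
    then have fB: "f \<in> Bij ?S" using Homeo_subset_Bij by blast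
    from f obtain g where g: "homeomorphic_maps M M f g"
      using car homeomorphic_map_maps by blast
    have gs: "g x = inv_into ?S f x" if "x \<in> ?S" for x
    proof -
      have "g x \<in> ?S" "f (g x) = x"
        using g that by (auto simp: homeomorphic_maps_def continuous_map_def Pi_iff)
      moreover have "inj_on f ?S" using fB by (auto simp: Bij_def bij_betw_def)
      ultimately show ?thesis by (metis inv_into_f_f)
    qed
    have "homeomorphic_map M M (restrict (inv_into ?S f) ?S)"
    proof (rule homeomorphic_map_eq)
      show "homeomorphic_map M M g"
        using g homeomorphic_maps_map by blast
      show "g x = restrict (inv_into ?S f) ?S x" if "x \<in> ?S" for x
        using gs [OF that] that by (simp only: restrict_apply')
    qed
    then show "inv\<^bsub>BijGroup ?S\<^esub> f \<in> carrier (Homeo M)"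
      by (simp add: car inv_BijGroup [OF fB])
  next
    fix f g assume fg: "f \<in> carrier (Homeo M)" "g \<in> carrier (Homeo M)"
    then have B: "f \<in> Bij ?S" "g \<in> Bij ?S" using Homeo_subset_Bij by blast+
    have "homeomorphic_map M M (f \<circ> g)"
      using fg car by (blast intro: homeomorphic_map_compose)
    then have "homeomorphic_map M M (compose ?S f g)"
      by (rule homeomorphic_map_eq) (auto simp: compose_def)
    then show "f \<otimes>\<^bsub>BijGroup ?S\<^esub> g \<in> carrier (Homeo M)"
      using B by (simp add: car BijGroup_def)
  qed
qed

lemma group_Homeo: "group (Homeo M)"
  using subgroup.subgroup_is_group [OF subgroup_Homeo group_BijGroup, of M]
  by (simp add: Homeo_def)


section \<open>First-order formulae in the language of groups\<close>

datatype grp_term = Var nat | One | Mult grp_term grp_term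

datatype grp_formula =
    Eq grp_term grp_term
  | Neg grp_formula
  | Conj grp_formula grp_formula
  | Ex nat grp_formula

primrec term_vars :: "grp_term \<Rightarrow> nat set" where
  "term_vars (Var i) = {i}"
| "term_vars One = {}"
| "term_vars (Mult s t) = term_vars s \<union> term_vars t"

primrec free_vars :: "grp_formula \<Rightarrow> nat set" where
  "free_vars (Eq s t) = term_vars s \<union> term_vars t"
| "free_vars (Neg p) = free_vars p"
| "free_vars (Conj p q) = free_vars p \<union> free_vars q"
| "free_vars (Ex i p) = free_vars p - {i}"

primrec term_val :: "('g, 'm) monoid_scheme \<Rightarrow> (nat \<Rightarrow> 'g) \<Rightarrow> grp_term \<Rightarrow> 'g" where
  "term_val G e (Var i) = e i"
| "term_val G e One = \<one>\<^bsub>G\<^esub>"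
| "term_val G e (Mult s t) = term_val G e s \<otimes>\<^bsub>G\<^esub> term_val G e t"

primrec sat :: "('g, 'm) monoid_scheme \<Rightarrow> (nat \<Rightarrow> 'g) \<Rightarrow> grp_formula \<Rightarrow> bool" where
  "sat G e (Eq s t) \<longleftrightarrow> term_val G e s = term_val G e t"
| "sat G e (Neg p) \<longleftrightarrow> \<not> sat G e p"
| "sat G e (Conj p q) \<longleftrightarrow> sat G e p \<and> sat G e q"
| "sat G e (Ex i p) \<longleftrightarrow> (\<exists>a\<in>carrier G. sat G (e(i := a)) p)"

text \<open>
  The distinguished free variable is \<open>Var 0\<close>.  The values that the constant assignment gives
  to the other variables are irrelevant, since those do not occur free.
\<close>

definition tp :: "('g, 'm) monoid_scheme \<Rightarrow> 'g \<Rightarrow> grp_formula set" where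
  "tp G g = {\<psi>. free_vars \<psi> \<subseteq> {0} \<and> sat G (\<lambda>_. g) \<psi>}"


section \<open>The Baire property\<close>

definition nowhere_dense_in :: "'a topology \<Rightarrow> 'a set \<Rightarrow> bool" where
  "nowhere_dense_in X A \<longleftrightarrow> A \<subseteq> topspace X \<and> X interior_of (X closure_of A) = {}"

definition meager_in :: "'a topology \<Rightarrow> 'a set \<Rightarrow> bool" where
  "meager_in X A \<longleftrightarrow> (\<exists>N :: nat \<Rightarrow> 'a set. (\<forall>n. nowhere_dense_in X (N n)) \<and> A = (\<Union>n. N n))"

definition has_Baire_property :: "'a topology \<Rightarrow> 'a set \<Rightarrow> bool" where
  "has_Baire_property X A \<longleftrightarrow> (\<exists>U. openin X U \<and> meager_in X (sym_diff A U))"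


section \<open>The boldface projective hierarchy\<close>

definition Baire_space :: "(nat \<Rightarrow> nat) topology" where
  "Baire_space = product_topology (\<lambda>_. discrete_topology UNIV) UNIV"

definition Borel_sets_in :: "'a topology \<Rightarrow> 'a set set" where
  "Borel_sets_in X = sigma_sets (topspace X) {U. openin X U}"

text \<open>The product of \<open>X\<close> with \<open>d\<close> copies of the Baire space.\<close>

definition times_Baire :: "'a topology \<Rightarrow> nat \<Rightarrow> ('a \<times> (nat \<Rightarrow> nat \<Rightarrow> nat)) topology" where
  "times_Baire X d = prod_topology X (product_topology (\<lambda>_. Baire_space) {..<d})"

text \<open>
  Projection from \<open>d + 1\<close> to \<open>d\<close> copies of the Baire space, forgetting the last one.  The
  restriction is needed because points of \<^const>\<open>product_topology\<close> are extensional functions.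
\<close>

definition project :: "nat \<Rightarrow> ('a \<times> (nat \<Rightarrow> nat \<Rightarrow> nat)) set \<Rightarrow> ('a \<times> (nat \<Rightarrow> nat \<Rightarrow> nat)) set" where
  "project d B = (\<lambda>(x, y). (x, restrict y {..<d})) ` B"

text \<open>
  \<open>Sigma1 X n d\<close> is the pointclass \<open>\<Sigma>\<^sup>1\<^sub>n\<close> (boldface) of subsets of \<open>times_Baire X d\<close>, for
  Polish \<open>X\<close>.  For \<open>n \<ge> 1\<close> these are the projections of the sets in \<open>\<Pi>\<^sup>1\<^sub>n\<^sub>-\<^sub>1\<close> one dimension
  higher, where \<open>\<Pi>\<^sup>1\<^sub>n\<close> consists of the complements of the sets in \<open>\<Sigma>\<^sup>1\<^sub>n\<close>.  The recursion starts,
  by convention, with the Borel sets at \<open>n = 0\<close>, so that level 1 consists of the projections of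
  Borel sets, that is, of the analytic sets.
\<close>

primrec Sigma1 ::
  "'a topology \<Rightarrow> nat \<Rightarrow> nat \<Rightarrow> ('a \<times> (nat \<Rightarrow> nat \<Rightarrow> nat)) set set" where
  "Sigma1 X 0 d = Borel_sets_in (times_Baire X d)"
| "Sigma1 X (Suc n) d =
     {project d (topspace (times_Baire X (Suc d)) - B) | B. B \<in> Sigma1 X n (Suc d)}"

text \<open>
  \<open>times_Baire X 0\<close> is homeomorphic to \<open>X\<close> via \<^const>\<open>fst\<close>, as its second factor is a single
  point.  Every \<open>\<Pi>\<^sup>1\<^sub>n\<close> set is \<open>\<Sigma>\<^sup>1\<^sub>n\<^sub>+\<^sub>1\<close>, so the union of the \<open>\<Sigma>\<close> classes is the whole hierarchy.
\<close>

definition projective_in :: "'a topology \<Rightarrow> 'a set \<Rightarrow> bool" where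
  "projective_in X A \<longleftrightarrow> (\<exists>n. \<exists>B\<in>Sigma1 X n 0. A = fst ` B)"

definition PBP :: bool where
  "PBP \<longleftrightarrow> (\<forall>A :: real set. projective_in euclideanreal A \<longrightarrow> has_Baire_property euclideanreal A)"

end

(*
  Homeomorphisms g(x), x real, supported in the spherical shell 1 < |p| < 2 of a chart, move each
  ray of the shell into itself.  On a ray, identified with the real line, g(x) fixes the integers
  and pushes the interval (i, i+1) up or down according to whether x + i*theta mod 1 lies in the
  first or second half of the unit interval, theta being irrational.  Then g(x+1) = g(x), and
  g(x+theta) is conjugate to g(x) by the shift along the rays.  Each set {x. Homeo(M) |= phi(g(x))}
  is therefore invariant under translation by Z + theta*Z.  It is projective: points and
  homeomorphisms of M are coded, through a countable base, by elements of the Baire space in such a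
  way that Homeo(M) becomes a structure with projective universe and multiplication.  By PBP and the
  topological zero-one law it is meager or comeager, so the type of g(x) is constant on a comeager
  set.  On the other hand, the orbits of g(x) that connect two fixed points form, on each ray, an
  integer line with edges oriented by the signs; a conjugation maps such lines to such lines, so
  only countably many sign sequences, hence few x, give conjugates of a fixed g(y).
*)

theory Submission
  imports Defs
begin

section \<open>Meager sets of reals and a zero-one law\<close>

text \<open>A conjugating homeomorphism need respect neither the chart nor the shell nor the rays,
  so non-conjugacy has to be detected by dynamics alone. Two fixed points are joined when some
  non-fixed point tends to one under forward and to the other under backward iteration. Fixed points
  off the rays are joined to nothing, and an integer point of a ray only to its two neighbours. A
  conjugation may turn a line around; it then also inverts the weights, which is why the two
  multipliers are 2 and its inverse. Shifts and reflections are both indexed by an integer, whence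
  the countability. Quantifiers over Homeo(M) become quantifiers over the Baire space, so formulae
  may climb to any finite level of the hierarchy; this is why the Baire property is assumed for all
  projective sets. The parameter is a real number, so that the assumption applies directly. The
  shell is compactly contained in one chart, so the maps extend by the identity to any manifold,
  compact or not. Since there are only countably many formulae, the exceptional meager sets of all
  of them can be discarded together.\<close>

lemma nowhere_dense_in_real_iff:
  "nowhere_dense_in euclideanreal A \<longleftrightarrow> interior (closure A) = {}"
  by (simp add: nowhere_dense_in_def)

lemma meager_in_subset:
  assumes "meager_in X A" "B \<subseteq> A"
  shows "meager_in X B"
proof -
  obtain N :: "nat \<Rightarrow> _" where N: "\<And>n. nowhere_dense_in X (N n)" "A = (\<Union>n. N n)"
    using assms(1) by (auto simp: meager_in_def)
  have "nowhere_dense_in X (N n \<inter> B)" for n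
  proof -
    have "X interior_of (X closure_of (N n \<inter> B)) \<subseteq> X interior_of (X closure_of (N n))"
      by (intro interior_of_mono closure_of_mono) auto
    then show ?thesis using N(1)[of n] by (auto simp: nowhere_dense_in_def)
  qed
  moreover have "B = (\<Union>n. N n \<inter> B)" using N assms by auto
  ultimately show ?thesis unfolding meager_in_def by (intro exI[of _ "\<lambda>n. N n \<inter> B"]) auto
qed

lemma meager_in_countable_Union:
  assumes "countable I" "\<And>i. i \<in> I \<Longrightarrow> meager_in X (A i)"
  shows "meager_in X (\<Union>i\<in>I. A i)"
proof -
  have "\<forall>i\<in>I. \<exists>N :: nat \<Rightarrow> _. (\<forall>n. nowhere_dense_in X (N n)) \<and> A i = (\<Union>n. N n)"
    using assms(2) by (auto simp: meager_in_def)
  then obtain N :: "_ \<Rightarrow> nat \<Rightarrow> _" where N: "\<And>i n. i \<in> I \<Longrightarrow> nowhere_dense_in X (N i n)"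
    "\<And>i. i \<in> I \<Longrightarrow> A i = (\<Union>n. N i n)"
    by metis
  let ?S = "insert {} ((\<lambda>(i, n). N i n) ` (I \<times> UNIV))"
  have cS: "countable ?S" "?S \<noteq> {}" using assms(1) by auto
  have "\<forall>A\<in>?S. nowhere_dense_in X A"
    using N(1) by (auto simp: nowhere_dense_in_def[of X "{}"])
  then have "nowhere_dense_in X (from_nat_into ?S k)" for k
    by (rule bspec) (rule from_nat_into[OF cS(2)])
  moreover have "(\<Union>i\<in>I. A i) = (\<Union>k. from_nat_into ?S k)"
    using range_from_nat_into[OF cS(2,1)] N(2) by auto
  ultimately show ?thesis unfolding meager_in_def by blast
qed

lemma meager_in_Un:
  assumes "meager_in X A" "meager_in X B"
  shows "meager_in X (A \<union> B)"
  using meager_in_countable_Union[of "UNIV :: bool set" X "\<lambda>b. if b then A else B"] assms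
  by (simp add: UNIV_bool Un_commute)

lemma countable_imp_meager_real:
  assumes "countable A"
  shows "meager_in euclideanreal A"
proof -
  have "meager_in euclideanreal {x}" for x :: real
    unfolding meager_in_def
    by (intro exI[of _ "\<lambda>_::nat. {x}"]) (auto simp: nowhere_dense_in_real_iff)
  then show ?thesis
    using meager_in_countable_Union[OF assms, of euclideanreal "\<lambda>x. {x}"] by simp
qed

lemma meager_real_translation:
  assumes "meager_in euclideanreal A"
  shows "meager_in euclideanreal ((+) c ` A)"
proof -
  obtain N :: "nat \<Rightarrow> _" where N: "\<And>n. interior (closure (N n)) = {}" "A = (\<Union>n. N n)"
    using assms by (auto simp: meager_in_def nowhere_dense_in_real_iff)
  have "interior (closure ((+) c ` N n)) = {}" for n
    by (simp add: closure_translation interior_translation N)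
  then show ?thesis
    unfolding meager_in_def nowhere_dense_in_real_iff
    by (intro exI[of _ "\<lambda>n. (+) c ` N n"]) (auto simp: N)
qed

lemma not_meager_real_interval:
  assumes "a < b"
  shows "\<not> meager_in euclideanreal {a<..<b}"
proof
  assume "meager_in euclideanreal {a<..<b}"
  then obtain N :: "nat \<Rightarrow> _" where N: "\<And>n. interior (closure (N n)) = {}" "{a<..<b} = (\<Union>n. N n)"
    by (auto simp: meager_in_def nowhere_dense_in_real_iff)
  have "euclideanreal interior_of \<Union>(range (\<lambda>n. closure (N n))) = {}"
    by (rule Baire_category_alt) (auto simp: N completely_metrizable_space_euclidean)
  moreover have "{a<..<b} \<subseteq> \<Union>(range (\<lambda>n. closure (N n)))"
    using N(2) closure_subset by fastforce
  then have "{a<..<b} \<subseteq> interior (\<Union>(range (\<lambda>n. closure (N n))))"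
    by (simp add: interior_maximal)
  ultimately show False using dense[OF assms] by auto
qed

text \<open>Kronecker's density theorem, aimed at the midpoint of the interval with half its length
  as tolerance.\<close>

lemma int_combinations_dense:
  fixes \<theta> :: real
  assumes "\<theta> \<notin> \<rat>" "a < b"
  obtains j k :: int where "a < x + of_int j + of_int k * \<theta>" "x + of_int j + of_int k * \<theta> < b"
proof -
  have "(b - a) / 2 > 0" using assms(2) by simp
  then obtain h k :: int where "\<bar>of_int k * \<theta> - of_int h - ((a + b) / 2 - x)\<bar> < (b - a) / 2"
    by (rule sequence_of_fractional_parts_is_dense[OF assms(1)])
  then have "a < x + of_int (-h) + of_int k * \<theta>" "x + of_int (-h) + of_int k * \<theta> < b"
    by (auto simp: abs_if field_simps split: if_splits)
  then show thesis using that by blast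
qed

text \<open>If \<open>A\<close> differs from a nonempty open set by a meager set, it is comeager in
  some interval. Every point outside \<open>A\<close> has a translate in that interval, still
  outside \<open>A\<close>, so the complement is covered by countably many translates of one meager
  set. If the open set is empty, \<open>A\<close> itself is meager.\<close>

lemma translation_zero_one_law:
  fixes A :: "real set" and \<theta> :: real
  assumes BP: "has_Baire_property euclideanreal A"
    and \<theta>: "\<theta> \<notin> \<rat>"
    and inv: "\<And>x. x + 1 \<in> A \<longleftrightarrow> x \<in> A" "\<And>x. x + \<theta> \<in> A \<longleftrightarrow> x \<in> A"
  shows "meager_in euclideanreal A \<or> meager_in euclideanreal (- A)"
proof -
  have int_inv: "x + of_int k * c \<in> A \<longleftrightarrow> x \<in> A" if "\<And>x. x + c \<in> A \<longleftrightarrow> x \<in> A" for x c k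
  proof (induction k rule: int_induct[where k = 0])
    case base
    then show ?case by simp
  next
    case (step1 i)
    then show ?case using that[of "x + of_int i * c"] by (simp add: algebra_simps)
  next
    case (step2 i)
    then show ?case using that[of "x + of_int (i - 1) * c"] by (simp add: algebra_simps)
  qed
  have invs: "x + of_int j + of_int k * \<theta> \<in> A \<longleftrightarrow> x \<in> A" for x j k
    using int_inv[OF inv(1), of x j] int_inv[OF inv(2), of "x + of_int j" k] by simp
  obtain U where U: "open U" "meager_in euclideanreal (sym_diff A U)"
    using BP by (auto simp: has_Baire_property_def)
  show ?thesis
  proof (cases "U = {}")
    case True
    then show ?thesis using U by simp
  next
    case False
    then obtain u where "u \<in> U" by auto
    then obtain e where e: "e > 0" "ball u e \<subseteq> U"
      using U(1) open_contains_ball by blast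
    let ?I = "{u - e<..<u + e}"
    have "?I - A \<subseteq> sym_diff A U" using e by (auto simp: ball_eq_greaterThanLessThan)
    then have m: "meager_in euclideanreal (?I - A)" using U(2) meager_in_subset by blast
    let ?T = "\<lambda>(j :: int, k :: int). (+) (- (of_int j + of_int k * \<theta>)) ` (?I - A)"
    have "meager_in euclideanreal (\<Union>p\<in>UNIV. ?T p)"
      by (rule meager_in_countable_Union) (auto intro: meager_real_translation m)
    moreover have "- A \<subseteq> (\<Union>p\<in>UNIV. ?T p)"
    proof
      fix x assume x: "x \<in> - A"
      have "u - e < u + e" using e by simp
      then obtain j k :: int where
        "u - e < x + of_int j + of_int k * \<theta>" "x + of_int j + of_int k * \<theta> < u + e"
        by (rule int_combinations_dense[OF \<theta>])
      then have "x + of_int j + of_int k * \<theta> \<in> ?I - A" using invs x by auto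
      then have "x \<in> ?T (j, k)"
        by (auto simp: image_iff intro!: bexI[of _ "x + of_int j + of_int k * \<theta>"])
      then show "x \<in> (\<Union>p\<in>UNIV. ?T p)" by blast
    qed
    ultimately show ?thesis using meager_in_subset by blast
  qed
qed

text \<open>For each \<open>i\<close> one of \<open>A i\<close> and its complement is meager and is
  thrown away; what is left lies on one side of every \<open>A i\<close> at once.\<close>

lemma countable_types_constant_on_comeager:
  fixes \<theta> :: real
  assumes "countable I" "\<theta> \<notin> \<rat>"
    and "\<And>i. i \<in> I \<Longrightarrow> has_Baire_property euclideanreal (A i)"
    and inv: "\<And>i x. i \<in> I \<Longrightarrow> x + 1 \<in> A i \<longleftrightarrow> x \<in> A i" "\<And>i x. i \<in> I \<Longrightarrow> x + \<theta> \<in> A i \<longleftrightarrow> x \<in> A i"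
  obtains C where "meager_in euclideanreal (- C)"
    "\<And>i x y. i \<in> I \<Longrightarrow> x \<in> C \<Longrightarrow> y \<in> C \<Longrightarrow> x \<in> A i \<longleftrightarrow> y \<in> A i"
proof -
  have 01: "meager_in euclideanreal (A i) \<or> meager_in euclideanreal (- A i)" if "i \<in> I" for i
    using translation_zero_one_law[OF assms(3)[OF that] assms(2)] inv that by blast
  define N where "N i = (if meager_in euclideanreal (A i) then A i else - A i)" for i
  have "meager_in euclideanreal (\<Union>i\<in>I. N i)"
    by (rule meager_in_countable_Union[OF assms(1)]) (use 01 in \<open>auto simp: N_def\<close>)
  then show thesis
    by (intro that[of "- (\<Union>i\<in>I. N i)"]) (auto simp: N_def split: if_splits)
qed

section \<open>Projective predicates\<close>

text \<open>The level is quantified away: the logical operations below may raise it, and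
  \<open>PBP\<close> only asks for its existence.\<close>

definition projective_pred :: "'a topology \<Rightarrow> nat \<Rightarrow> ('a \<times> (nat \<Rightarrow> nat \<Rightarrow> nat) \<Rightarrow> bool) \<Rightarrow> bool" where
  "projective_pred X d \<Phi> \<longleftrightarrow> (\<exists>n. {w \<in> topspace (times_Baire X d). \<Phi> w} \<in> Sigma1 X n d)"

definition Borel_pred :: "'a topology \<Rightarrow> nat \<Rightarrow> ('a \<times> (nat \<Rightarrow> nat \<Rightarrow> nat) \<Rightarrow> bool) \<Rightarrow> bool" where
  "Borel_pred X d \<Phi> \<longleftrightarrow> {w \<in> topspace (times_Baire X d). \<Phi> w} \<in> Borel_sets_in (times_Baire X d)"

text \<open>
  Relations on the Baire space are shown to be projective after composition with arbitrary continuous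
  terms, which stand for the free variables; no separate substitution rule is then needed.
\<close>

abbreviation Baire_term :: "'a topology \<Rightarrow> nat \<Rightarrow> ('a \<times> (nat \<Rightarrow> nat \<Rightarrow> nat) \<Rightarrow> nat \<Rightarrow> nat) \<Rightarrow> bool" where
  "Baire_term X d t \<equiv> continuous_map (times_Baire X d) Baire_space t"

definition trunc :: "nat \<Rightarrow> 'a \<times> (nat \<Rightarrow> nat \<Rightarrow> nat) \<Rightarrow> 'a \<times> (nat \<Rightarrow> nat \<Rightarrow> nat)" where
  "trunc d w = (fst w, restrict (snd w) {..<d})"

definition extend :: "nat \<Rightarrow> 'a \<times> (nat \<Rightarrow> nat \<Rightarrow> nat) \<Rightarrow> (nat \<Rightarrow> nat) \<Rightarrow> 'a \<times> (nat \<Rightarrow> nat \<Rightarrow> nat)" where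
  "extend d w z = (fst w, (snd w)(d := z))"

section \<open>Borel sets, projections and continuous substitutions\<close>

lemma topspace_Baire_space [simp]: "topspace Baire_space = UNIV"
  by (simp add: Baire_space_def)

lemma topspace_times_Baire: "topspace (times_Baire X d) = topspace X \<times> ({..<d} \<rightarrow>\<^sub>E UNIV)"
  by (simp add: times_Baire_def)

lemma sigma_algebra_Borel_sets_in: "sigma_algebra (topspace X) (Borel_sets_in X)"
  unfolding Borel_sets_in_def by (rule sigma_algebra_sigma_sets) (auto dest: openin_subset)

interpretation Borel_sets_in: sigma_algebra "topspace X" "Borel_sets_in X" for X :: "'x topology"
  by (rule sigma_algebra_Borel_sets_in)

lemma Borel_sets_in_open: "openin X U \<Longrightarrow> U \<in> Borel_sets_in X"
  unfolding Borel_sets_in_def by (rule sigma_sets.Basic) simp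

lemma Borel_sets_in_vimage:
  assumes f: "continuous_map X Y f" and "B \<in> Borel_sets_in Y"
  shows "{x \<in> topspace X. f x \<in> B} \<in> Borel_sets_in X"
proof -
  have fY: "f x \<in> topspace Y" if "x \<in> topspace X" for x
    using f that by (auto simp: continuous_map_def)
  from assms(2) show ?thesis
    unfolding Borel_sets_in_def[of Y]
  proof (induction rule: sigma_sets.induct)
    case (Basic U)
    then show ?case using f openin_continuous_map_preimage Borel_sets_in_open by blast
  next
    case Empty
    then show ?case by simp
  next
    case (Compl U)
    have "{x \<in> topspace X. f x \<in> topspace Y - U} = topspace X - {x \<in> topspace X. f x \<in> U}"
      using fY by auto
    then show ?case using Compl by (metis Borel_sets_in.compl_sets)
  next
    case (Union U)
    have "{x \<in> topspace X. f x \<in> (\<Union>i. U i)} = (\<Union>i::nat. {x \<in> topspace X. f x \<in> U i})" by auto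
    then show ?case using Union by (metis (no_types, lifting) Borel_sets_in.countable_nat_UN image_subsetI)
  qed
qed

lemma project_eq_trunc: "project d B = trunc d ` B"
  by (simp add: project_def trunc_def case_prod_beta)

lemma snd_times_Baire_outside: "w \<in> topspace (times_Baire X d) \<Longrightarrow> \<not> i < d \<Longrightarrow> snd w i = undefined"
  by (auto simp: topspace_times_Baire mem_Times_iff PiE_iff extensional_def)

lemma trunc_extend:
  assumes "w \<in> topspace (times_Baire X d)"
  shows "trunc d (extend d w z) = w"
proof (rule prod_eqI)
  show "snd (trunc d (extend d w z)) = snd w"
    using snd_times_Baire_outside[OF assms] by (intro ext) (simp add: trunc_def extend_def restrict_def)
qed (simp add: trunc_def extend_def)

lemma extend_trunc:
  assumes "w \<in> topspace (times_Baire X (Suc d))"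
  shows "extend d (trunc d w) (snd w d) = w"
proof (rule prod_eqI)
  show "snd (extend d (trunc d w) (snd w d)) = snd w"
    using snd_times_Baire_outside[OF assms] by (intro ext) (auto simp: trunc_def extend_def restrict_def)
qed (simp add: trunc_def extend_def)

lemma in_project_iff:
  assumes B: "B \<subseteq> topspace (times_Baire X (Suc d))" and w: "w \<in> topspace (times_Baire X d)"
  shows "w \<in> project d B \<longleftrightarrow> (\<exists>z. extend d w z \<in> B)"
proof
  assume "w \<in> project d B"
  then obtain v where v: "v \<in> B" "w = trunc d v" unfolding project_eq_trunc by blast
  then have "extend d w (snd v d) \<in> B" using extend_trunc[of v X d] B by auto
  then show "\<exists>z. extend d w z \<in> B" by blast
next
  assume "\<exists>z. extend d w z \<in> B"
  then obtain z where z: "extend d w z \<in> B" ..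
  have "w = trunc d (extend d w z)" using trunc_extend[OF w] by simp
  then show "w \<in> project d B" unfolding project_eq_trunc using z by (rule image_eqI)
qed

lemma project_subset:
  assumes "B \<subseteq> topspace (times_Baire X (Suc d))"
  shows "project d B \<subseteq> topspace (times_Baire X d)"
  using assms by (auto simp: project_def topspace_times_Baire subset_iff)

lemma extend_in_topspace:
  assumes "w \<in> topspace (times_Baire X d)"
  shows "extend d w z \<in> topspace (times_Baire X (Suc d))"
  using assms snd_times_Baire_outside[OF assms]
  by (simp add: extend_def topspace_times_Baire mem_Times_iff PiE_iff extensional_def)

lemma snd_extend [simp]: "snd (extend d w z) d = z"
  by (simp add: extend_def)

lemma in_project_compl_iff:
  assumes "w \<in> topspace (times_Baire X d)"
  shows "w \<in> project d (topspace (times_Baire X (Suc d)) - C) \<longleftrightarrow> (\<exists>z. extend d w z \<notin> C)"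
  using in_project_iff[OF Diff_subset assms, of C] extend_in_topspace[OF assms] by auto

text \<open>The negated membership mirrors the recursion for \<open>Sigma1\<close>, whose level
  \<open>Suc n\<close> consists of projections of complements. Recognizing such a set amounts to
  exhibiting \<open>C\<close>.\<close>

lemma Collect_eq_project_compl:
  assumes "\<And>w. w \<in> topspace (times_Baire X d) \<Longrightarrow> \<Phi> w \<longleftrightarrow> (\<exists>z. extend d w z \<notin> C)"
  shows "{w \<in> topspace (times_Baire X d). \<Phi> w} = project d (topspace (times_Baire X (Suc d)) - C)"
    (is "?L = ?R")
proof (rule Set.set_eqI)
  fix w
  have "?R \<subseteq> topspace (times_Baire X d)" by (rule project_subset) (rule Diff_subset)
  then show "w \<in> ?L \<longleftrightarrow> w \<in> ?R"
    using assms[of w] in_project_compl_iff[of w X d C] by blast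
qed

lemma continuous_map_times_Baire_fst: "continuous_map (times_Baire X d) X fst"
  unfolding times_Baire_def by (rule continuous_map_fst)

lemma continuous_map_times_Baire_coord:
  assumes "i < d"
  shows "Baire_term X d (\<lambda>w. snd w i)"
proof -
  have "continuous_map (product_topology (\<lambda>_. Baire_space) {..<d}) Baire_space (\<lambda>y. y i)"
    by (rule continuous_map_product_projection) (use assms in simp)
  then show ?thesis
    unfolding times_Baire_def using continuous_map_compose[OF continuous_map_snd] by (fastforce simp: o_def)
qed

lemma continuous_map_into_times_Baire:
  assumes "continuous_map Y X f" "\<And>i. i < d \<Longrightarrow> continuous_map Y Baire_space (\<lambda>w. g w i)"
    "\<And>w. w \<in> topspace Y \<Longrightarrow> g w \<in> extensional {..<d}"
  shows "continuous_map Y (times_Baire X d) (\<lambda>w. (f w, g w))"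
  unfolding times_Baire_def continuous_map_pairwise
  using assms by (auto simp: o_def continuous_map_componentwise)

lemma continuous_map_trunc: "continuous_map (times_Baire X (Suc d)) (times_Baire X d) (trunc d)"
  unfolding trunc_def
  by (rule continuous_map_into_times_Baire)
    (auto intro: continuous_map_times_Baire_fst continuous_map_times_Baire_coord)

lemma Sigma1_subset: "B \<in> Sigma1 X n d \<Longrightarrow> B \<subseteq> topspace (times_Baire X d)"
proof (induction n arbitrary: d B)
  case 0
  then show ?case using Borel_sets_in.sets_into_space by auto
next
  case (Suc n)
  then obtain C where "B = project d (topspace (times_Baire X (Suc d)) - C)" by auto
  then show ?case using project_subset[OF Diff_subset] by metis
qed

text \<open>Lifts a substitution under a quantifier: the quantified coordinate is carried along
  unchanged.\<close>

lemma continuous_map_extend: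
  assumes "continuous_map (times_Baire X d) (times_Baire Y d') \<sigma>"
  shows "continuous_map (times_Baire X (Suc d)) (times_Baire Y (Suc d'))
           (\<lambda>w. extend d' (\<sigma> (trunc d w)) (snd w d))"
proof -
  have \<sigma>': "continuous_map (times_Baire X (Suc d)) (times_Baire Y d') (\<lambda>w. \<sigma> (trunc d w))"
    using continuous_map_compose[OF continuous_map_trunc assms] by (simp add: o_def)
  have 1: "continuous_map (times_Baire X (Suc d)) Y (\<lambda>w. fst (\<sigma> (trunc d w)))"
    using continuous_map_compose[OF \<sigma>' continuous_map_times_Baire_fst] by (simp add: o_def)
  have 2: "Baire_term X (Suc d) (\<lambda>w. snd (\<sigma> (trunc d w)) i)" if "i < d'" for i
    using continuous_map_compose[OF \<sigma>' continuous_map_times_Baire_coord[OF that]] by (simp add: o_def)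
  have 3: "\<sigma> (trunc d w) \<in> topspace (times_Baire Y d')" if "w \<in> topspace (times_Baire X (Suc d))" for w
    using \<sigma>' that by (auto simp: continuous_map_def)
  show ?thesis
    unfolding extend_def
  proof (rule continuous_map_into_times_Baire[OF 1])
    show "Baire_term X (Suc d) (\<lambda>w. ((snd (\<sigma> (trunc d w)))(d' := snd w d)) i)" if "i < Suc d'" for i
      using that 2[of i] continuous_map_times_Baire_coord[of d "Suc d" X] by (cases "i = d'") auto
    show "(snd (\<sigma> (trunc d w)))(d' := snd w d) \<in> extensional {..<Suc d'}"
      if "w \<in> topspace (times_Baire X (Suc d))" for w
      using 3[OF that] by (auto simp: topspace_times_Baire PiE_iff extensional_def)
  qed
qed

text \<open>Preimages commute with projection when the substitution leaves the projected coordinate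
  alone, so the induction lifts \<open>\<sigma>\<close> by one coordinate per level.\<close>

lemma Sigma1_vimage:
  assumes "B \<in> Sigma1 Y n d'" "continuous_map (times_Baire X d) (times_Baire Y d') \<sigma>"
  shows "{w \<in> topspace (times_Baire X d). \<sigma> w \<in> B} \<in> Sigma1 X n d"
  using assms
proof (induction n arbitrary: d d' \<sigma> B)
  case 0
  then show ?case using Borel_sets_in_vimage by auto
next
  case (Suc n)
  obtain C where C: "C \<in> Sigma1 Y n (Suc d')" "B = project d' (topspace (times_Baire Y (Suc d')) - C)"
    using Suc.prems(1) by auto
  define \<tau> where "\<tau> w = extend d' (\<sigma> (trunc d w)) (snd w d)" for w
  have \<tau>: "continuous_map (times_Baire X (Suc d)) (times_Baire Y (Suc d')) \<tau>"
    unfolding \<tau>_def by (rule continuous_map_extend[OF Suc.prems(2)])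
  let ?C = "{w \<in> topspace (times_Baire X (Suc d)). \<tau> w \<in> C}"
  have "{w \<in> topspace (times_Baire X d). \<sigma> w \<in> B} = project d (topspace (times_Baire X (Suc d)) - ?C)"
  proof (rule Collect_eq_project_compl)
    fix w
    assume w: "w \<in> topspace (times_Baire X d)"
    then have \<sigma>w: "\<sigma> w \<in> topspace (times_Baire Y d')"
      using Suc.prems(2) by (auto simp: continuous_map_def)
    show "\<sigma> w \<in> B \<longleftrightarrow> (\<exists>z. extend d w z \<notin> ?C)"
      unfolding C(2) in_project_compl_iff[OF \<sigma>w]
      by (simp add: \<tau>_def extend_in_topspace[OF w] trunc_extend[OF w])
  qed
  then show ?case using Suc.IH[OF C(1) \<tau>] by auto
qed

section \<open>Closure of the projective predicates under logical operations\<close>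

lemma projective_pred_not:
  assumes "projective_pred X d \<Phi>"
  shows "projective_pred X d (\<lambda>w. \<not> \<Phi> w)"
proof -
  obtain n where n: "{w \<in> topspace (times_Baire X d). \<Phi> w} \<in> Sigma1 X n d" (is "?B \<in> _")
    using assms by (auto simp: projective_pred_def)
  \<comment> \<open>A dummy coordinate turns the complement into a projection of a complement, which
    is the form of level \<open>Suc n\<close>.\<close>
  let ?C = "{w \<in> topspace (times_Baire X (Suc d)). trunc d w \<in> ?B}"
  have "?C \<in> Sigma1 X n (Suc d)" by (rule Sigma1_vimage[OF n continuous_map_trunc])
  moreover have "{w \<in> topspace (times_Baire X d). \<not> \<Phi> w}
      = project d (topspace (times_Baire X (Suc d)) - ?C)"
    by (rule Collect_eq_project_compl) (simp add: extend_in_topspace trunc_extend)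
  ultimately have "{w \<in> topspace (times_Baire X d). \<not> \<Phi> w} \<in> Sigma1 X (Suc n) d" by auto
  then show ?thesis unfolding projective_pred_def by blast
qed

lemma Sigma1_ex:
  assumes "{w \<in> topspace (times_Baire X (Suc d)). \<Psi> w} \<in> Sigma1 X n (Suc d)"
  shows "{w \<in> topspace (times_Baire X d). \<exists>z. \<not> \<Psi> (extend d w z)} \<in> Sigma1 X (Suc n) d"
proof -
  have "{w \<in> topspace (times_Baire X d). \<exists>z. \<not> \<Psi> (extend d w z)}
      = project d (topspace (times_Baire X (Suc d)) - {w \<in> topspace (times_Baire X (Suc d)). \<Psi> w})"
    by (rule Collect_eq_project_compl) (simp add: extend_in_topspace)
  then show ?thesis using assms by auto
qed

lemma projective_pred_cong:
  assumes "projective_pred X d \<Phi>" "\<And>w. w \<in> topspace (times_Baire X d) \<Longrightarrow> \<Phi> w \<longleftrightarrow> \<Psi> w"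
  shows "projective_pred X d \<Psi>"
proof -
  have "{w \<in> topspace (times_Baire X d). \<Phi> w} = {w \<in> topspace (times_Baire X d). \<Psi> w}"
    by (intro Collect_cong conj_cong refl assms(2))
  then show ?thesis using assms(1) by (simp only: projective_pred_def)
qed

text \<open>\<open>Sigma1_ex\<close> quantifies a negated predicate, so it is applied to the
  negation of \<open>\<Phi>\<close>, whose level may be higher. The last coordinate
  \<open>snd w d\<close> stands for the bound variable.\<close>

lemma projective_pred_ex:
  assumes "projective_pred X (Suc d) (\<lambda>w. \<Phi> (trunc d w) (snd w d))"
  shows "projective_pred X d (\<lambda>w. \<exists>z. \<Phi> w z)"
proof -
  obtain n where "{w \<in> topspace (times_Baire X (Suc d)). \<not> \<Phi> (trunc d w) (snd w d)} \<in> Sigma1 X n (Suc d)"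
    using projective_pred_not[OF assms] by (auto simp: projective_pred_def)
  from Sigma1_ex[OF this]
  have "\<exists>n. {w \<in> topspace (times_Baire X d). \<exists>z. \<Phi> (trunc d (extend d w z)) z} \<in> Sigma1 X n d"
    by (intro exI[of _ "Suc n"]) (simp only: not_not snd_extend)
  then have "projective_pred X d (\<lambda>w. \<exists>z. \<Phi> (trunc d (extend d w z)) z)"
    unfolding projective_pred_def .
  then show ?thesis by (rule projective_pred_cong) (simp add: trunc_extend)
qed

lemma Collect_trunc_eq:
  "{w \<in> topspace (times_Baire X (Suc d)). \<Phi> (trunc d w)}
    = {w \<in> topspace (times_Baire X (Suc d)). trunc d w \<in> {w \<in> topspace (times_Baire X d). \<Phi> w}}"
proof -
  have "trunc d w \<in> topspace (times_Baire X d)" if "w \<in> topspace (times_Baire X (Suc d))" for w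
    using continuous_map_trunc[of X d] that by (auto simp: continuous_map_def)
  then show ?thesis by blast
qed

lemma projective_pred_cylinder:
  assumes "projective_pred X d \<Phi>"
  shows "projective_pred X (Suc d) (\<lambda>w. \<Phi> (trunc d w))"
proof -
  obtain n where n: "{w \<in> topspace (times_Baire X d). \<Phi> w} \<in> Sigma1 X n d"
    using assms unfolding projective_pred_def by blast
  show ?thesis
    unfolding projective_pred_def Collect_trunc_eq
    by (rule exI) (rule Sigma1_vimage[OF n continuous_map_trunc])
qed

lemma Borel_pred_iff_Sigma1_0: "Borel_pred X d \<Phi> \<longleftrightarrow> {w \<in> topspace (times_Baire X d). \<Phi> w} \<in> Sigma1 X 0 d"
  by (simp add: Borel_pred_def)

lemma projective_pred_Borel: "Borel_pred X d \<Phi> \<Longrightarrow> projective_pred X d \<Phi>"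
  unfolding Borel_pred_iff_Sigma1_0 projective_pred_def by blast

lemma Borel_pred_conj: "Borel_pred X d \<Phi> \<Longrightarrow> Borel_pred X d \<Psi> \<Longrightarrow> Borel_pred X d (\<lambda>w. \<Phi> w \<and> \<Psi> w)"
  unfolding Borel_pred_def
  by (rule Borel_sets_in.sets_Collect_conj)

lemma Borel_pred_not: "Borel_pred X d \<Phi> \<Longrightarrow> Borel_pred X d (\<lambda>w. \<not> \<Phi> w)"
  unfolding Borel_pred_def
  by (rule Borel_sets_in.sets_Collect_neg)

text \<open>
  Moving the quantifiers of two projective predicates to the front one at a time avoids coding
  pairs of points of the Baire space by a single point.  The class \<open>K\<close> is first the Borel and
  then the projective predicates.
\<close>

lemma projective_pred_conj_aux:
  assumes "{w \<in> topspace (times_Baire X d). \<Phi> w} \<in> Sigma1 X n d"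
    and base: "\<And>d \<Phi> \<Psi>. Borel_pred X d \<Phi> \<Longrightarrow> K d \<Psi> \<Longrightarrow>
      projective_pred X d (\<lambda>w. \<Phi> w \<and> \<Psi> w) \<and> projective_pred X d (\<lambda>w. \<Phi> w \<or> \<Psi> w)"
    and K: "\<And>d \<Psi>. K d \<Psi> \<Longrightarrow> K (Suc d) (\<lambda>w. \<not> \<Psi> (trunc d w))"
    and "K d \<Psi>"
  shows "projective_pred X d (\<lambda>w. \<Phi> w \<and> \<Psi> w) \<and> projective_pred X d (\<lambda>w. \<Phi> w \<or> \<Psi> w)"
  using assms(1,4)
proof (induction n arbitrary: d \<Phi> \<Psi>)
  case 0
  then show ?case using base by (simp add: Borel_pred_def)
next
  case (Suc n)
  obtain C where C: "C \<in> Sigma1 X n (Suc d)"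
    "{w \<in> topspace (times_Baire X d). \<Phi> w} = project d (topspace (times_Baire X (Suc d)) - C)"
    using Suc.prems(1) by auto
  have Ceq: "{w \<in> topspace (times_Baire X (Suc d)). w \<in> C} = C" using Sigma1_subset[OF C(1)] by auto
  have \<Phi>: "\<Phi> w \<longleftrightarrow> (\<exists>z. extend d w z \<notin> C)" if "w \<in> topspace (times_Baire X d)" for w
  proof -
    have "\<Phi> w \<longleftrightarrow> w \<in> project d (topspace (times_Baire X (Suc d)) - C)" using C(2) that by blast
    also have "\<dots> \<longleftrightarrow> (\<exists>z. extend d w z \<notin> C)"
      using extend_in_topspace[OF that] that by (simp add: in_project_compl_iff)
    finally show ?thesis .
  qed
  note IH = Suc.IH[OF _ K[OF Suc.prems(2)], of "\<lambda>w. w \<in> C", unfolded Ceq, OF C(1)]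
  \<comment> \<open>With \<open>\<Phi> w\<close> written as
    \<open>\<exists>z. extend d w z \<notin> C\<close>, the quantifier moves in front of the whole
    conjunction, whose matrix is by De Morgan a negated disjunction. Hence \<open>K\<close> has to
    be closed under padded negation, and both connectives are carried through the induction.\<close>
  have "projective_pred X (Suc d) (\<lambda>w. \<not> (w \<in> C \<or> \<not> \<Psi> (trunc d w)))"
    using IH projective_pred_not by blast
  then have "projective_pred X (Suc d) (\<lambda>w. \<not> (extend d (trunc d w) (snd w d) \<in> C \<or> \<not> \<Psi> (trunc d w)))"
    by (rule projective_pred_cong) (simp add: extend_trunc)
  then have "projective_pred X d (\<lambda>w. \<exists>z. \<not> (extend d w z \<in> C \<or> \<not> \<Psi> w))"
    by (rule projective_pred_ex)
  then have 1: "projective_pred X d (\<lambda>w. \<Phi> w \<and> \<Psi> w)"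
    by (rule projective_pred_cong) (auto simp: \<Phi>)
  have "projective_pred X (Suc d) (\<lambda>w. \<not> (w \<in> C \<and> \<not> \<Psi> (trunc d w)))"
    using IH projective_pred_not by blast
  then have "projective_pred X (Suc d) (\<lambda>w. \<not> (extend d (trunc d w) (snd w d) \<in> C \<and> \<not> \<Psi> (trunc d w)))"
    by (rule projective_pred_cong) (simp add: extend_trunc)
  then have "projective_pred X d (\<lambda>w. \<exists>z. \<not> (extend d w z \<in> C \<and> \<not> \<Psi> w))"
    by (rule projective_pred_ex)
  then have "projective_pred X d (\<lambda>w. \<Phi> w \<or> \<Psi> w)"
    by (rule projective_pred_cong) (auto simp: \<Phi>)
  with 1 show ?case by blast
qed

lemma Borel_pred_cylinder:
  assumes "Borel_pred X d \<Phi>"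
  shows "Borel_pred X (Suc d) (\<lambda>w. \<Phi> (trunc d w))"
  unfolding Borel_pred_def Collect_trunc_eq
  by (rule Borel_sets_in_vimage[OF continuous_map_trunc]) (use assms in \<open>simp add: Borel_pred_def\<close>)

lemma projective_pred_conj:
  assumes "projective_pred X d \<Phi>" "projective_pred X d \<Psi>"
  shows "projective_pred X d (\<lambda>w. \<Phi> w \<and> \<Psi> w)"
proof -
  have BB: "projective_pred X d (\<lambda>w. \<Phi> w \<and> \<Psi> w) \<and> projective_pred X d (\<lambda>w. \<Phi> w \<or> \<Psi> w)"
    if "Borel_pred X d \<Phi>" "Borel_pred X d \<Psi>" for d \<Phi> \<Psi>
    using projective_pred_Borel[OF Borel_pred_conj[OF that]]
      projective_pred_Borel[OF Borel_pred_not[OF Borel_pred_conj[OF that[THEN Borel_pred_not]]]]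
    by simp
  \<comment> \<open>Induction on the level of \<open>\<Psi>\<close>, with the two sides exchanged,
    settles the case of a Borel \<open>\<Phi>\<close>. This is then the base case of the induction
    on the level of \<open>\<Phi>\<close>.\<close>
  have BP: "projective_pred X d (\<lambda>w. \<Phi> w \<and> \<Psi> w) \<and> projective_pred X d (\<lambda>w. \<Phi> w \<or> \<Psi> w)"
    if B: "Borel_pred X d \<Phi>" and P: "projective_pred X d \<Psi>" for d \<Phi> \<Psi>
  proof -
    obtain n where n: "{w \<in> topspace (times_Baire X d). \<Psi> w} \<in> Sigma1 X n d"
      using P by (auto simp: projective_pred_def)
    have "projective_pred X d (\<lambda>w. \<Psi> w \<and> \<Phi> w) \<and> projective_pred X d (\<lambda>w. \<Psi> w \<or> \<Phi> w)"
      by (rule projective_pred_conj_aux[where K = "Borel_pred X", OF n BB _ B])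
        (simp_all add: Borel_pred_not Borel_pred_cylinder)
    then show ?thesis by (simp add: conj_commute disj_commute)
  qed
  obtain n where n: "{w \<in> topspace (times_Baire X d). \<Phi> w} \<in> Sigma1 X n d"
    using assms(1) by (auto simp: projective_pred_def)
  have "projective_pred X d (\<lambda>w. \<Phi> w \<and> \<Psi> w) \<and> projective_pred X d (\<lambda>w. \<Phi> w \<or> \<Psi> w)"
    by (rule projective_pred_conj_aux[where K = "projective_pred X", OF n BP _ assms(2)])
      (simp_all add: projective_pred_not projective_pred_cylinder)
  then show ?thesis ..
qed

lemma projective_pred_disj:
  assumes "projective_pred X d \<Phi>" "projective_pred X d \<Psi>"
  shows "projective_pred X d (\<lambda>w. \<Phi> w \<or> \<Psi> w)"
  using projective_pred_not[OF projective_pred_conj[OF assms[THEN projective_pred_not]]] by simp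

lemma projective_pred_imp:
  assumes "projective_pred X d \<Phi>" "projective_pred X d \<Psi>"
  shows "projective_pred X d (\<lambda>w. \<Phi> w \<longrightarrow> \<Psi> w)"
  using projective_pred_disj[OF projective_pred_not[OF assms(1)] assms(2)] by simp

lemma projective_pred_iff:
  assumes "projective_pred X d \<Phi>" "projective_pred X d \<Psi>"
  shows "projective_pred X d (\<lambda>w. \<Phi> w \<longleftrightarrow> \<Psi> w)"
  using projective_pred_conj[OF projective_pred_imp[OF assms] projective_pred_imp[OF assms(2,1)]]
  by (simp add: iff_conv_conj_imp)

lemma projective_pred_all:
  assumes "projective_pred X (Suc d) (\<lambda>w. \<Phi> (trunc d w) (snd w d))"
  shows "projective_pred X d (\<lambda>w. \<forall>z. \<Phi> w z)"
  using projective_pred_not[OF projective_pred_ex[where \<Phi> = "\<lambda>w z. \<not> \<Phi> w z", OF projective_pred_not[OF assms]]]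
  by simp

section \<open>Borel predicates: countable quantifiers and conditions on entries\<close>

lemma Borel_pred_const: "Borel_pred X d (\<lambda>_. c)"
  unfolding Borel_pred_def
  by (rule Borel_sets_in.sets_Collect_const)

lemma Borel_pred_disj: "Borel_pred X d \<Phi> \<Longrightarrow> Borel_pred X d \<Psi> \<Longrightarrow> Borel_pred X d (\<lambda>w. \<Phi> w \<or> \<Psi> w)"
  using Borel_pred_not[OF Borel_pred_conj[OF Borel_pred_not Borel_pred_not]] by simp

lemma Borel_pred_imp: "Borel_pred X d \<Phi> \<Longrightarrow> Borel_pred X d \<Psi> \<Longrightarrow> Borel_pred X d (\<lambda>w. \<Phi> w \<longrightarrow> \<Psi> w)"
  using Borel_pred_disj[OF Borel_pred_not] by simp

lemma Borel_pred_ex_countable: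
  fixes \<Phi> :: "'i :: countable \<Rightarrow> _"
  assumes "\<And>i. Borel_pred X d (\<Phi> i)"
  shows "Borel_pred X d (\<lambda>w. \<exists>i. \<Phi> i w)"
  using assms unfolding Borel_pred_def
  by (rule Borel_sets_in.sets_Collect_countable_Ex)

lemma Borel_pred_all_countable:
  fixes \<Phi> :: "'i :: countable \<Rightarrow> _"
  assumes "\<And>i. Borel_pred X d (\<Phi> i)"
  shows "Borel_pred X d (\<lambda>w. \<forall>i. \<Phi> i w)"
  using assms unfolding Borel_pred_def
  by (rule Borel_sets_in.sets_Collect_countable_All)

text \<open>Evaluation at \<open>n\<close> is continuous into a discrete space, so the condition is
  even open.\<close>

lemma Borel_pred_term_eq:
  assumes "Baire_term X d t"
  shows "Borel_pred X d (\<lambda>w. t w n = k)"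
proof -
  have "continuous_map Baire_space (discrete_topology UNIV) (\<lambda>y. y n)"
    unfolding Baire_space_def by (rule continuous_map_product_projection) simp
  from continuous_map_compose[OF assms this]
  have "continuous_map (times_Baire X d) (discrete_topology UNIV) (\<lambda>w. t w n)" by (simp add: o_def)
  from openin_continuous_map_preimage[OF this, of "{k}"]
  show ?thesis unfolding Borel_pred_def by (intro Borel_sets_in_open) simp
qed

lemma Borel_pred_fst:
  assumes "A \<in> Borel_sets_in X"
  shows "Borel_pred X d (\<lambda>w. fst w \<in> A)"
  unfolding Borel_pred_def by (rule Borel_sets_in_vimage[OF continuous_map_times_Baire_fst assms])

lemma Baire_term_trunc: "Baire_term X d t \<Longrightarrow> Baire_term X (Suc d) (\<lambda>w. t (trunc d w))"
  using continuous_map_compose[OF continuous_map_trunc] by (fastforce simp: o_def)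

lemma Baire_term_last: "Baire_term X (Suc d) (\<lambda>w. snd w d)"
  by (rule continuous_map_times_Baire_coord) simp

lemma Borel_pred_eq_terms:
  assumes "Baire_term X d s" "Baire_term X d t"
  shows "Borel_pred X d (\<lambda>w. s w = t w)"
proof -
  have "Borel_pred X d (\<lambda>w. \<forall>n k. s w n = k \<longrightarrow> t w n = k)"
    by (intro Borel_pred_all_countable Borel_pred_imp Borel_pred_term_eq assms)
  then show ?thesis by (simp add: fun_eq_iff eq_commute)
qed

lemma projective_in_of_pred:
  assumes "projective_pred X 0 (\<lambda>w. fst w \<in> A)" "A \<subseteq> topspace X"
  shows "projective_in X A"
proof -
  have "A = fst ` {w \<in> topspace (times_Baire X 0). fst w \<in> A}"
    using assms(2) by (force simp: topspace_times_Baire)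
  then show ?thesis using assms(1) unfolding projective_pred_def projective_in_def by blast
qed

section \<open>Definable sets in projective structures\<close>

text \<open>Isomorphism invariance, by induction on the formula. It serves twice: for passing from
  homeomorphisms to their codes, and for inner automorphisms.\<close>

lemma sat_iso_image:
  assumes inj: "inj_on c (carrier G)" and im: "c ` carrier G = carrier H"
    and one: "c \<one>\<^bsub>G\<^esub> = \<one>\<^bsub>H\<^esub>" "\<one>\<^bsub>G\<^esub> \<in> carrier G"
    and mult: "\<And>a b. a \<in> carrier G \<Longrightarrow> b \<in> carrier G \<Longrightarrow> a \<otimes>\<^bsub>G\<^esub> b \<in> carrier G"
      "\<And>a b. a \<in> carrier G \<Longrightarrow> b \<in> carrier G \<Longrightarrow> c (a \<otimes>\<^bsub>G\<^esub> b) = c a \<otimes>\<^bsub>H\<^esub> c b"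
    and e: "\<And>i. e i \<in> carrier G"
  shows "sat H (c \<circ> e) \<psi> \<longleftrightarrow> sat G e \<psi>"
  using e
proof (induction \<psi> arbitrary: e)
  case (Eq s t)
  have *: "term_val G e u \<in> carrier G \<and> term_val H (c \<circ> e) u = c (term_val G e u)" for u
    by (induction u) (use Eq one mult in auto)
  show ?case unfolding sat.simps by (metis * inj inj_on_eq_iff)
next
  case (Ex i \<psi>)
  have "sat H ((c \<circ> e)(i := c a)) \<psi> \<longleftrightarrow> sat G (e(i := a)) \<psi>" if "a \<in> carrier G" for a
  proof -
    have "(c \<circ> e)(i := c a) = c \<circ> e(i := a)" by auto
    moreover have "(e(i := a)) j \<in> carrier G" for j using Ex.prems that by simp
    ultimately show ?thesis using Ex.IH[of "e(i := a)"] by metis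
  qed
  then show ?case unfolding sat.simps im[symmetric] by blast
qed auto

text \<open>Multiplication is constrained through its graph. The unit is a single point of the Baire
  space, hence given by a constant continuous term.\<close>

definition projective_structure :: "'a topology \<Rightarrow> ((nat \<Rightarrow> nat), 'm) monoid_scheme \<Rightarrow> bool" where
  "projective_structure X G \<longleftrightarrow>
     (\<forall>d t. Baire_term X d t \<longrightarrow> projective_pred X d (\<lambda>w. t w \<in> carrier G)) \<and>
     (\<forall>d r s t. Baire_term X d r \<longrightarrow> Baire_term X d s \<longrightarrow> Baire_term X d t \<longrightarrow>
        projective_pred X d (\<lambda>w. r w \<otimes>\<^bsub>G\<^esub> s w = t w))"

lemma projective_structure_carrier:
  "projective_structure X G \<Longrightarrow> Baire_term X d t \<Longrightarrow> projective_pred X d (\<lambda>w. t w \<in> carrier G)"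
  unfolding projective_structure_def by blast

lemma projective_structure_mult:
  "projective_structure X G \<Longrightarrow> Baire_term X d r \<Longrightarrow> Baire_term X d s \<Longrightarrow> Baire_term X d t \<Longrightarrow>
    projective_pred X d (\<lambda>w. r w \<otimes>\<^bsub>G\<^esub> s w = t w)"
  unfolding projective_structure_def by blast

text \<open>As multiplication is known only through its graph, a term is unnested: the values of its
  two factors are named by existential quantifiers.\<close>

lemma projective_term_val:
  assumes G: "projective_structure X G"
    and "\<And>i. Baire_term X d (\<tau> i)" "Baire_term X d s"
  shows "projective_pred X d (\<lambda>w. term_val G (\<lambda>i. \<tau> i w) t = s w)"
  using assms(2,3)
proof (induction t arbitrary: d \<tau> s)
  case (Var i)
  then show ?case by (auto intro: projective_pred_Borel Borel_pred_eq_terms)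
next
  case One
  have "Baire_term X d (\<lambda>_. \<one>\<^bsub>G\<^esub>)" by simp
  from Borel_pred_eq_terms[OF this One(2)] show ?case by (auto intro: projective_pred_Borel)
next
  case (Mult t u)
  have "projective_pred X d (\<lambda>w. \<exists>a b. term_val G (\<lambda>i. \<tau> i w) t = a \<and>
      term_val G (\<lambda>i. \<tau> i w) u = b \<and> a \<otimes>\<^bsub>G\<^esub> b = s w)"
    by (intro projective_pred_ex projective_pred_conj Mult.IH projective_structure_mult[OF G]
        Baire_term_trunc Baire_term_last Mult.prems)
  then show ?case by simp
qed

text \<open>Each quantifier of the formula adds one Baire coordinate, relativized to the carrier;
  hence \<open>d\<close> and \<open>\<tau>\<close> are arbitrary in the induction.\<close>

lemma projective_sat:
  assumes G: "projective_structure X G"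
    and "\<And>i. Baire_term X d (\<tau> i)"
  shows "projective_pred X d (\<lambda>w. sat G (\<lambda>i. \<tau> i w) \<psi>)"
  using assms(2)
proof (induction \<psi> arbitrary: d \<tau>)
  case (Eq s t)
  have "projective_pred X d (\<lambda>w. \<exists>a. term_val G (\<lambda>i. \<tau> i w) s = a \<and> term_val G (\<lambda>i. \<tau> i w) t = a)"
    by (intro projective_pred_ex projective_pred_conj projective_term_val[OF G] Baire_term_trunc
        Baire_term_last Eq.prems)
  then show ?case by (rule projective_pred_cong) auto
next
  case (Neg \<psi>)
  then show ?case by (simp add: projective_pred_not)
next
  case (Conj \<phi> \<psi>)
  then show ?case by (simp add: projective_pred_conj)
next
  case (Ex i \<psi>)
  have "projective_pred X (Suc d) (\<lambda>w. sat G (\<lambda>j. (if j = i then \<lambda>w. snd w d else (\<lambda>w. \<tau> j (trunc d w))) w) \<psi>)"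
    by (rule Ex.IH) (simp add: Baire_term_trunc Baire_term_last Ex.prems)
  moreover have "(\<lambda>j. (if j = i then \<lambda>w. snd w d else (\<lambda>w. \<tau> j (trunc d w))) w)
      = (\<lambda>j. \<tau> j (trunc d w))(i := snd w d)" for w :: "'a \<times> _"
    by auto
  ultimately have "projective_pred X (Suc d) (\<lambda>w. sat G ((\<lambda>j. \<tau> j (trunc d w))(i := snd w d)) \<psi>)"
    by simp
  moreover have "projective_pred X (Suc d) (\<lambda>w. snd w d \<in> carrier G)"
    by (rule projective_structure_carrier[OF G Baire_term_last])
  ultimately have "projective_pred X d (\<lambda>w. \<exists>a. a \<in> carrier G \<and> sat G ((\<lambda>j. \<tau> j w)(i := a)) \<psi>)"
    by (intro projective_pred_ex[where \<Phi> = "\<lambda>w a. a \<in> carrier G \<and> sat G ((\<lambda>j. \<tau> j w)(i := a)) \<psi>"]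
        projective_pred_conj)
  then show ?case by (simp add: Bex_def)
qed

section \<open>Coding points and homeomorphisms by elements of the Baire space\<close>

lemma carrier_Homeo: "carrier (Homeo M) = {f \<in> extensional (topspace M). homeomorphic_map M M f}"
  by (simp add: Homeo_def)

lemma mult_Homeo:
  "f \<in> carrier (Homeo M) \<Longrightarrow> g \<in> carrier (Homeo M) \<Longrightarrow> f \<otimes>\<^bsub>Homeo M\<^esub> g = compose (topspace M) f g"
  using Homeo_subset_Bij[of M] by (simp add: Homeo_def BijGroup_def subset_iff)

lemma continuous_Homeo: "f \<in> carrier (Homeo M) \<Longrightarrow> continuous_map M M f"
  by (simp add: carrier_Homeo homeomorphic_imp_continuous_map)

text \<open>What the coding uses of a manifold. Local compactness lets a family of basic sets be
  recognized as the neighbourhoods of an actual point.\<close>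

locale based_space =
  fixes M :: "'a topology" and B :: "nat \<Rightarrow> 'a set"
  assumes Hausdorff: "Hausdorff_space M"
    and locally_compact: "locally_compact_space M"
    and open_base: "openin M (B n)"
    and base: "openin M U \<Longrightarrow> p \<in> U \<Longrightarrow> \<exists>n. p \<in> B n \<and> B n \<subseteq> U"
begin

definition point_code :: "'a \<Rightarrow> nat \<Rightarrow> nat" where
  "point_code p n = (if p \<in> B n then 1 else 0)"

definition map_code :: "('a \<Rightarrow> 'a) \<Rightarrow> nat \<Rightarrow> nat" where
  "map_code f k = (case prod_decode k of (m, n) \<Rightarrow> if f ` B m \<subseteq> B n then 1 else 0)"

text \<open>For codes of a continuous \<open>f\<close> and of points \<open>p\<close>,
  \<open>q\<close> this says that every basic neighbourhood of \<open>q\<close> contains the image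
  of one of \<open>p\<close>. That one-sided condition already forces \<open>f p = q\<close>,
  because points are separated by basic sets.\<close>

definition graph_code :: "(nat \<Rightarrow> nat) \<Rightarrow> (nat \<Rightarrow> nat) \<Rightarrow> (nat \<Rightarrow> nat) \<Rightarrow> bool" where
  "graph_code r y z \<longleftrightarrow> (\<forall>n. z n = 1 \<longrightarrow> (\<exists>m. y m = 1 \<and> r (prod_encode (m, n)) = 1))"

abbreviation point_codes :: "(nat \<Rightarrow> nat) set" where
  "point_codes \<equiv> point_code ` topspace M"

text \<open>Nonemptiness of \<open>B j\<close> keeps finite intersections nonempty in the
  compactness argument. The relation does not involve the sequence being tested, so it counts as a
  constant when complexity is computed.\<close>

definition compactly_inside :: "nat \<Rightarrow> nat \<Rightarrow> bool" where
  "compactly_inside j n \<longleftrightarrow> B j \<noteq> {} \<and> compactin M (M closure_of B j) \<and> M closure_of B j \<subseteq> B n"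

lemma base_subset_topspace: "B n \<subseteq> topspace M"
  by (rule openin_subset[OF open_base])

lemma point_code_eq_1: "point_code p n = 1 \<longleftrightarrow> p \<in> B n"
  by (simp add: point_code_def)

lemma map_code_eq_1: "map_code f (prod_encode (m, n)) = 1 \<longleftrightarrow> f ` B m \<subseteq> B n"
  by (simp add: map_code_def)

declare point_code_eq_1 [simp] map_code_eq_1 [simp]
  point_code_eq_1 [unfolded One_nat_def, simp] map_code_eq_1 [unfolded One_nat_def, simp]

lemma base_compact:
  assumes "openin M U" "p \<in> U"
  obtains j where "p \<in> B j" "compactin M (M closure_of B j)" "M closure_of B j \<subseteq> U"
proof -
  obtain V C where VC: "openin M V" "compactin M C" "closedin M C" "p \<in> V" "V \<subseteq> C" "C \<subseteq> U"
    using locally_compact Hausdorff assms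
    unfolding locally_compact_space_neighbourhood_base_closedin[OF disjI1[OF Hausdorff]] neighbourhood_base_of
    by meson
  obtain j where j: "p \<in> B j" "B j \<subseteq> V" using base VC by blast
  have "M closure_of B j \<subseteq> C" using VC j by (meson closure_of_minimal order_trans)
  moreover have "compactin M (M closure_of B j)"
    using closed_compactin[OF VC(2)] calculation closedin_closure_of by blast
  ultimately show thesis using that j VC by blast
qed

lemma separate_points:
  assumes "p \<in> topspace M" "q \<in> topspace M" "p \<noteq> q"
  obtains n where "p \<in> B n" "q \<notin> B n"
proof -
  obtain U where "openin M U" "p \<in> U" "q \<notin> U"
    using Hausdorff assms unfolding Hausdorff_space_def disjnt_iff by metis
  then show thesis using base that by blast
qed

text \<open>
  The conditions on the right are countable combinations of conditions on entries.  They suffice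
  because, by compactness, the closures of the sets in such a directed family have a point in common.
\<close>

lemma in_point_codes_iff:
  "y \<in> point_codes \<longleftrightarrow> (\<forall>n. y n = 0 \<or> y n = 1) \<and> (\<exists>n. y n = 1) \<and>
     (\<forall>m n. y m = 1 \<and> y n = 1 \<longrightarrow> (\<exists>k. y k = 1 \<and> compactly_inside k m \<and> compactly_inside k n)) \<and>
     (\<forall>j n. compactly_inside j n \<longrightarrow> y n = 1 \<or> (\<exists>m. y m = 1 \<and> B m \<inter> B j = {}))"
  (is "?L \<longleftrightarrow> ?R01 \<and> ?Rne \<and> ?Rdir \<and> ?Rpr")
proof (intro iffI conjI)
  assume ?L
  then obtain p where p: "p \<in> topspace M" "y = point_code p" by auto
  show ?R01 by (simp add: p point_code_def)
  show ?Rne using base[of "topspace M" p] p by auto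
  show ?Rdir
  proof (intro allI impI)
    fix m n assume "y m = 1 \<and> y n = 1"
    then have "p \<in> B m \<inter> B n" by (simp add: p)
    then obtain k where "p \<in> B k" "compactin M (M closure_of B k)" "M closure_of B k \<subseteq> B m \<inter> B n"
      using base_compact openin_Int[OF open_base open_base] by metis
    then show "\<exists>k. y k = 1 \<and> compactly_inside k m \<and> compactly_inside k n"
      by (intro exI[of _ k]) (auto simp: p compactly_inside_def)
  qed
  show ?Rpr
  proof (intro allI impI)
    fix j n assume j: "compactly_inside j n"
    show "y n = 1 \<or> (\<exists>m. y m = 1 \<and> B m \<inter> B j = {})"
    proof (cases "p \<in> B n")
      case False
      then have "p \<in> topspace M - M closure_of B j" using j p by (auto simp: compactly_inside_def)
      then obtain m where "p \<in> B m" "B m \<subseteq> topspace M - M closure_of B j"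
        using base openin_diff[OF openin_topspace closedin_closure_of] by metis
      moreover have "B j \<subseteq> M closure_of B j" by (rule closure_of_subset[OF base_subset_topspace])
      ultimately have "p \<in> B m" "B m \<inter> B j = {}" by blast+
      then show ?thesis by (auto simp: p)
    qed (simp add: p)
  qed
next
  assume "?R01 \<and> ?Rne \<and> ?Rdir \<and> ?Rpr"
  then have r01: ?R01 and ne: ?Rne and dir: ?Rdir and pr: ?Rpr by blast+
  obtain n0 where "y n0 = 1" using ne by blast
  then obtain k0 where k0: "y k0 = 1" "compactly_inside k0 n0" using dir by blast
  \<comment> \<open>Directedness, extended to finite families: the finite intersection property for
    the closures inside the compact closure of \<open>B k0\<close>.\<close>
  have finite_dir: "\<exists>k. y k = 1 \<and> B k \<noteq> {} \<and> (\<forall>i\<in>I. B k \<subseteq> B i)"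
    if "finite I" "\<forall>i\<in>I. y i = 1" for I
    using that
  proof (induction I rule: finite_induct)
    case empty
    then show ?case using k0 by (auto simp: compactly_inside_def)
  next
    case (insert i I)
    from insert.IH insert.prems obtain k where k: "y k = 1" "\<forall>i\<in>I. B k \<subseteq> B i" by auto
    have "y k = 1 \<and> y i = 1" using k insert.prems by simp
    then obtain l where l: "y l = 1" "compactly_inside l k" "compactly_inside l i"
      using dir[THEN spec[of _ k], THEN spec[of _ i]] by blast
    moreover have "B l \<subseteq> M closure_of B l" by (rule closure_of_subset[OF base_subset_topspace])
    ultimately have "B l \<subseteq> B k" "B l \<subseteq> B i" "B l \<noteq> {}" by (auto simp: compactly_inside_def)
    then show ?case using l k by (intro exI[of _ l]) auto
  qed
  let ?K = "M closure_of B k0" and ?F = "(\<lambda>k. M closure_of B k) ` {k. y k = 1}"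
  have "compactin M ?K" using k0 by (simp add: compactly_inside_def)
  then have fip: "(\<forall>C\<in>\<U>. closedin M C) \<Longrightarrow>
      (\<forall>\<F>. finite \<F> \<and> \<F> \<subseteq> \<U> \<longrightarrow> ?K \<inter> \<Inter>\<F> \<noteq> {}) \<Longrightarrow> ?K \<inter> \<Inter>\<U> \<noteq> {}" for \<U>
    unfolding compactin_fip by blast
  have fin: "?K \<inter> \<Inter>\<F> \<noteq> {}" if \<F>: "finite \<F>" "\<F> \<subseteq> ?F" for \<F>
  proof -
    obtain I where I: "finite I" "I \<subseteq> {k. y k = 1}" "\<F> = (\<lambda>k. M closure_of B k) ` I"
      using finite_subset_image[OF \<F>] by blast
    have "finite (insert k0 I)" "\<forall>i\<in>insert k0 I. y i = 1" using I k0 by auto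
    then obtain k where k: "B k \<noteq> {}" "\<forall>i\<in>insert k0 I. B k \<subseteq> B i"
      using finite_dir by meson
    then have "B k \<subseteq> M closure_of B i" if "i \<in> insert k0 I" for i
      using closure_of_subset[OF base_subset_topspace, of i] that by blast
    then have "B k \<subseteq> ?K \<inter> \<Inter>\<F>" using I by auto
    then show ?thesis using k(1) by blast
  qed
  have "?K \<inter> \<Inter>?F \<noteq> {}"
    by (rule fip) (use fin in auto)
  then obtain p where "p \<in> ?K \<inter> \<Inter>?F" by blast
  then have pK: "p \<in> M closure_of B k" if "y k = 1" for k using that by blast
  have "p \<in> topspace M" using pK[OF k0(1)] closure_of_subset_topspace by (rule subsetD[rotated])
  moreover have "y n = 1 \<longleftrightarrow> p \<in> B n" for n
  proof
    assume "y n = 1"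
    then obtain k where "y k = 1" "compactly_inside k n" using dir by blast
    then show "p \<in> B n" using pK by (auto simp: compactly_inside_def)
  next
    assume "p \<in> B n"
    then obtain j where j: "p \<in> B j" "compactin M (M closure_of B j)" "M closure_of B j \<subseteq> B n"
      using base_compact[OF open_base] by blast
    then have "compactly_inside j n" by (auto simp: compactly_inside_def)
    \<comment> \<open>The alternative offered by the last clause would place \<open>p\<close> in two
      disjoint basic sets, so that clause must give \<open>y n = 1\<close>.\<close>
    moreover have False if "y m = 1" "B m \<inter> B j = {}" for m
    proof -
      obtain k where k: "y k = 1" "compactly_inside k m" using dir \<open>y m = 1\<close> by blast
      then have "p \<in> B m" using pK[OF k(1)] by (auto simp: compactly_inside_def)
      then show False using that j by auto
    qed
    ultimately show "y n = 1" using pr by blast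
  qed
  then have "y = point_code p"
    using r01 by (intro ext) (metis point_code_def)
  ultimately show ?L by blast
qed

lemma graph_code_map_code:
  assumes f: "continuous_map M M f" and p: "p \<in> topspace M" and q: "q \<in> topspace M"
  shows "graph_code (map_code f) (point_code p) (point_code q) \<longleftrightarrow> f p = q"
proof
  assume g: "graph_code (map_code f) (point_code p) (point_code q)"
  show "f p = q"
  proof (rule ccontr)
    assume "f p \<noteq> q"
    moreover have "f p \<in> topspace M" using f p by (auto simp: continuous_map_def)
    ultimately obtain n where "q \<in> B n" "f p \<notin> B n" using separate_points[OF q] by metis
    then show False using g by (auto simp: graph_code_def)
  qed
next
  assume "f p = q"
  have "\<exists>m. p \<in> B m \<and> f ` B m \<subseteq> B n" if "q \<in> B n" for n
  proof -
    have "openin M {x \<in> topspace M. f x \<in> B n}"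
      using openin_continuous_map_preimage[OF f open_base] .
    moreover have "p \<in> {x \<in> topspace M. f x \<in> B n}" using that \<open>f p = q\<close> p by simp
    ultimately obtain m where "p \<in> B m" "B m \<subseteq> {x \<in> topspace M. f x \<in> B n}" using base by blast
    then show ?thesis by blast
  qed
  then show "graph_code (map_code f) (point_code p) (point_code q)"
    by (simp add: graph_code_def)
qed

text \<open>Numbers are quantified as entries of sequences, so all quantifiers range over the Baire space.\<close>

definition entry_at :: "(nat \<Rightarrow> nat) \<Rightarrow> (nat \<Rightarrow> nat) \<Rightarrow> nat \<Rightarrow> bool" where
  "entry_at y v i \<longleftrightarrow> y (v i) = 1"

definition pair_entry :: "(nat \<Rightarrow> nat) \<Rightarrow> (nat \<Rightarrow> nat) \<Rightarrow> bool" where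
  "pair_entry r v \<longleftrightarrow> r (prod_encode (v 0, v 1)) = 1"

text \<open>The second clause makes the coded relation total. The third, by which the relation
  determines the entries of \<open>r\<close>, does double duty: it makes the relation single-valued,
  since two images could be separated by a basic set, and it makes \<open>r\<close> the
  \<open>map_code\<close> of the resulting function.\<close>

definition continuous_code :: "(nat \<Rightarrow> nat) \<Rightarrow> bool" where
  "continuous_code r \<longleftrightarrow> (\<forall>k. r k = 0 \<or> r k = 1) \<and>
     (\<forall>y. y \<in> point_codes \<longrightarrow> (\<exists>z. z \<in> point_codes \<and> graph_code r y z)) \<and>
     (\<forall>v. pair_entry r v \<longleftrightarrow>
        (\<forall>y z. y \<in> point_codes \<and> z \<in> point_codes \<and> entry_at y v 0 \<and> graph_code r y z \<longrightarrow> entry_at z v 1))"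

lemma all_pair_of_seq: "(\<forall>v :: nat \<Rightarrow> 'b. \<Phi> (v 0) (v 1)) \<longleftrightarrow> (\<forall>m n. \<Phi> m n)"
proof (intro iffI allI)
  fix m n assume "\<forall>v :: nat \<Rightarrow> 'b. \<Phi> (v 0) (v 1)"
  from this[THEN spec[of _ "\<lambda>i. if i = 0 then m else n"]] show "\<Phi> m n" by simp
qed simp

lemma continuous_code_iff: "continuous_code r \<longleftrightarrow> (\<exists>f. continuous_map M M f \<and> r = map_code f)"
proof
  assume r: "continuous_code r"
  then have r01: "\<And>k. r k = 0 \<or> r k = 1"
    and tot: "\<And>p. p \<in> topspace M \<Longrightarrow> \<exists>q. q \<in> topspace M \<and> graph_code r (point_code p) (point_code q)"
    by (auto simp: continuous_code_def)
  have "\<forall>m n. r (prod_encode (m, n)) = 1 \<longleftrightarrow>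
        (\<forall>y z. y \<in> point_codes \<and> z \<in> point_codes \<and> y m = 1 \<and> graph_code r y z \<longrightarrow> z n = 1)"
    using r unfolding continuous_code_def pair_entry_def entry_at_def all_pair_of_seq[symmetric] by blast
  then have "r (prod_encode (m, n)) = 1 \<longleftrightarrow>
      (\<forall>y\<in>point_codes. \<forall>z\<in>point_codes. y m = 1 \<and> graph_code r y z \<longrightarrow> z n = 1)" for m n
    by blast
  then have stable: "r (prod_encode (m, n)) = 1 \<longleftrightarrow>
      (\<forall>p\<in>topspace M. \<forall>q\<in>topspace M. p \<in> B m \<and> graph_code r (point_code p) (point_code q) \<longrightarrow> q \<in> B n)"
    for m n by simp
  obtain f where f: "\<And>p. p \<in> topspace M \<Longrightarrow> f p \<in> topspace M \<and> graph_code r (point_code p) (point_code (f p))"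
    using tot by metis
  have uniq: "q = f p"
    if pq: "p \<in> topspace M" "q \<in> topspace M" "graph_code r (point_code p) (point_code q)" for p q
  proof (rule ccontr)
    assume "q \<noteq> f p"
    then obtain n where n: "q \<in> B n" "f p \<notin> B n"
      using separate_points[OF pq(2) conjunct1[OF f[OF pq(1)]]] by metis
    then obtain m where "p \<in> B m" "r (prod_encode (m, n)) = 1"
      using pq(3) by (auto simp: graph_code_def)
    then show False using n stable f pq by blast
  qed
  have r_iff: "r (prod_encode (m, n)) = 1 \<longleftrightarrow> f ` B m \<subseteq> B n" for m n
    unfolding stable using f uniq base_subset_topspace by blast
  have "continuous_map M M f"
    unfolding continuous_map_def
  proof (intro conjI allI impI)
    show "f \<in> topspace M \<rightarrow> topspace M" using f by auto
    fix U assume U: "openin M U"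
    show "openin M {p \<in> topspace M. f p \<in> U}"
    proof (subst openin_subopen, clarify)
      fix p assume p: "p \<in> topspace M" "f p \<in> U"
      then obtain n where n: "f p \<in> B n" "B n \<subseteq> U" using base U by blast
      then obtain m where "p \<in> B m" "r (prod_encode (m, n)) = 1"
        using f[OF p(1)] by (auto simp: graph_code_def)
      then have "p \<in> B m \<and> B m \<subseteq> {p \<in> topspace M. f p \<in> U}"
        using n r_iff base_subset_topspace by blast
      then show "\<exists>T. openin M T \<and> p \<in> T \<and> T \<subseteq> {p \<in> topspace M. f p \<in> U}" using open_base by blast
    qed
  qed
  moreover have "r k = map_code f k" for k
  proof -
    obtain m n where "k = prod_encode (m, n)" by (metis prod_decode_inverse surj_pair)
    then show ?thesis using r01[of k] r_iff[of m n] map_code_def[of f k] by auto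
  qed
  ultimately show "\<exists>f. continuous_map M M f \<and> r = map_code f" by blast
next
  assume "\<exists>f. continuous_map M M f \<and> r = map_code f"
  then obtain f where f: "continuous_map M M f" and r: "r = map_code f" by blast
  have fM: "f p \<in> topspace M" if "p \<in> topspace M" for p using f that by (auto simp: continuous_map_def)
  have 1: "r k = 0 \<or> r k = 1" for k by (simp add: r map_code_def split: prod.split)
  have 2: "\<exists>z. z \<in> point_codes \<and> graph_code r y z" if "y \<in> point_codes" for y
    using that graph_code_map_code[OF f] fM r by blast
  have 3: "r (prod_encode (m, n)) = 1 \<longleftrightarrow>
      (\<forall>y z. y \<in> point_codes \<and> z \<in> point_codes \<and> y m = 1 \<and> graph_code r y z \<longrightarrow> z n = 1)" for m n
  proof -
    have "(\<forall>y z. y \<in> point_codes \<and> z \<in> point_codes \<and> y m = 1 \<and> graph_code r y z \<longrightarrow> z n = 1)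
      \<longleftrightarrow> (\<forall>y\<in>point_codes. \<forall>z\<in>point_codes. y m = 1 \<and> graph_code r y z \<longrightarrow> z n = 1)"
      by blast
    also have "\<dots> \<longleftrightarrow> (\<forall>p\<in>topspace M. p \<in> B m \<longrightarrow> f p \<in> B n)"
      using fM by (auto simp: r graph_code_map_code[OF f])
    also have "\<dots> \<longleftrightarrow> f ` B m \<subseteq> B n" using base_subset_topspace by blast
    also have "\<dots> \<longleftrightarrow> r (prod_encode (m, n)) = 1" by (simp add: r)
    finally show ?thesis by (rule sym)
  qed
  show "continuous_code r" unfolding continuous_code_def pair_entry_def entry_at_def using 1 2 3 by blast
qed

section \<open>Codes of homeomorphisms and the group they form\<close>

definition homeo_code :: "(nat \<Rightarrow> nat) \<Rightarrow> bool" where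
  "homeo_code r \<longleftrightarrow> continuous_code r \<and> (\<exists>s. continuous_code s \<and>
     (\<forall>y z. y \<in> point_codes \<and> z \<in> point_codes \<longrightarrow> (graph_code r y z \<longleftrightarrow> graph_code s z y)))"

lemma map_code_restrict: "map_code (restrict f (topspace M)) = map_code f"
proof -
  have "restrict f (topspace M) ` B m = f ` B m" for m
    using base_subset_topspace[of m] by (intro image_cong) (auto simp: restrict_def)
  then show ?thesis by (simp add: map_code_def fun_eq_iff)
qed

lemma homeo_code_iff: "homeo_code r \<longleftrightarrow> r \<in> map_code ` carrier (Homeo M)"
proof
  assume "homeo_code r"
  then obtain f g where f: "continuous_map M M f" "r = map_code f" and g: "continuous_map M M g"
    and inv: "\<And>y z. y \<in> point_codes \<Longrightarrow> z \<in> point_codes \<Longrightarrow>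
      graph_code (map_code f) y z \<longleftrightarrow> graph_code (map_code g) z y"
    unfolding homeo_code_def continuous_code_iff by blast
  have fg: "f p = q \<longleftrightarrow> g q = p" if "p \<in> topspace M" "q \<in> topspace M" for p q
    using inv[of "point_code p" "point_code q"] that graph_code_map_code[OF f(1)] graph_code_map_code[OF g]
    by blast
  have "homeomorphic_maps M M f g"
    unfolding homeomorphic_maps_def
    using f(1) g fg by (auto simp: continuous_map_def Pi_iff)
  then have "homeomorphic_map M M f" using homeomorphic_map_maps by blast
  then have "homeomorphic_map M M (restrict f (topspace M))"
    by (rule homeomorphic_map_eq) simp
  then have "restrict f (topspace M) \<in> carrier (Homeo M)" by (simp add: carrier_Homeo)
  then show "r \<in> map_code ` carrier (Homeo M)" using f(2) map_code_restrict by (metis imageI)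
next
  assume "r \<in> map_code ` carrier (Homeo M)"
  then obtain f where f: "homeomorphic_map M M f" "r = map_code f" by (auto simp: carrier_Homeo)
  then obtain g where fg: "homeomorphic_maps M M f g" using homeomorphic_map_maps by blast
  then have c: "continuous_map M M f" "continuous_map M M g" by (auto simp: homeomorphic_maps_def)
  have "f p = q \<longleftrightarrow> g q = p" if "p \<in> topspace M" "q \<in> topspace M" for p q
    using fg that by (auto simp: homeomorphic_maps_def)
  then have "graph_code r y z \<longleftrightarrow> graph_code (map_code g) z y" if "y \<in> point_codes" "z \<in> point_codes" for y z
    using that f(2) graph_code_map_code[OF c(1)] graph_code_map_code[OF c(2)] by auto
  then show "homeo_code r"
    unfolding homeo_code_def continuous_code_iff using c f(2) by blast
qed

lemma inj_map_code: "inj_on map_code (carrier (Homeo M))"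
proof (rule inj_onI)
  fix f g assume fg: "f \<in> carrier (Homeo M)" "g \<in> carrier (Homeo M)" "map_code f = map_code g"
  show "f = g"
  proof (rule extensionalityI)
    show "f \<in> extensional (topspace M)" "g \<in> extensional (topspace M)"
      using fg by (simp_all add: carrier_Homeo)
    fix p assume p: "p \<in> topspace M"
    have q: "g p \<in> topspace M" using continuous_Homeo[OF fg(2)] p by (auto simp: continuous_map_def)
    show "f p = g p"
      using graph_code_map_code[OF continuous_Homeo[OF fg(1)] p q]
        graph_code_map_code[OF continuous_Homeo[OF fg(2)] p q] fg(3) by simp
  qed
qed

text \<open>Off the codes the multiplication is the first projection, which is as definable as the rest.\<close>

definition code_group :: "(nat \<Rightarrow> nat) monoid" where
  "code_group = \<lparr>carrier = map_code ` carrier (Homeo M),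
     mult = (\<lambda>r s. if homeo_code r \<and> homeo_code s
       then map_code (inv_into (carrier (Homeo M)) map_code r \<otimes>\<^bsub>Homeo M\<^esub> inv_into (carrier (Homeo M)) map_code s)
       else r),
     one = map_code \<one>\<^bsub>Homeo M\<^esub>\<rparr>"

lemma mult_code_group:
  assumes "f \<in> carrier (Homeo M)" "g \<in> carrier (Homeo M)"
  shows "map_code f \<otimes>\<^bsub>code_group\<^esub> map_code g = map_code (f \<otimes>\<^bsub>Homeo M\<^esub> g)"
  using assms inj_map_code by (simp add: code_group_def homeo_code_iff)

text \<open>Composition is expressed by following points, so that the graph of the multiplication is
  described by quantifiers over the Baire space, without \<open>inv_into\<close>.\<close>

lemma mult_code_group_iff:
  "r \<otimes>\<^bsub>code_group\<^esub> s = t \<longleftrightarrow>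
     (homeo_code r \<and> homeo_code s \<and> homeo_code t \<and>
       (\<forall>y z u. y \<in> point_codes \<and> z \<in> point_codes \<and> u \<in> point_codes \<and>
          graph_code s y z \<and> graph_code r z u \<longrightarrow> graph_code t y u)) \<or>
     (\<not> (homeo_code r \<and> homeo_code s) \<and> r = t)"
proof (cases "homeo_code r \<and> homeo_code s")
  case False
  then show ?thesis by (auto simp: code_group_def)
next
  case True
  then obtain f g where f: "f \<in> carrier (Homeo M)" "r = map_code f"
    and g: "g \<in> carrier (Homeo M)" "s = map_code g" unfolding homeo_code_iff by blast
  note c = f(1)[THEN continuous_Homeo] g(1)[THEN continuous_Homeo]
  have fM: "f p \<in> topspace M" "g p \<in> topspace M" if "p \<in> topspace M" for p
    using c that by (auto simp: continuous_map_def)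
  have fg: "f \<otimes>\<^bsub>Homeo M\<^esub> g \<in> carrier (Homeo M)"
    using monoid.m_closed[OF group.is_monoid[OF group_Homeo]] f g by blast
  have app: "(f \<otimes>\<^bsub>Homeo M\<^esub> g) p = f (g p)" if "p \<in> topspace M" for p
    using that f g by (simp add: mult_Homeo compose_def)
  have "t = map_code (f \<otimes>\<^bsub>Homeo M\<^esub> g) \<longleftrightarrow> homeo_code t \<and>
      (\<forall>y z u. y \<in> point_codes \<and> z \<in> point_codes \<and> u \<in> point_codes \<and>
          graph_code s y z \<and> graph_code r z u \<longrightarrow> graph_code t y u)" (is "?L \<longleftrightarrow> ?R")
  proof
    assume ?L
    then show ?R
      using fg f g graph_code_map_code[OF c(1)] graph_code_map_code[OF c(2)]
        graph_code_map_code[OF continuous_Homeo[OF fg]] app homeo_code_iff by auto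
  next
    assume R: ?R
    then obtain h where h: "h \<in> carrier (Homeo M)" "t = map_code h" unfolding homeo_code_iff by blast
    have "h = f \<otimes>\<^bsub>Homeo M\<^esub> g"
    proof (rule extensionalityI)
      show "h \<in> extensional (topspace M)" "f \<otimes>\<^bsub>Homeo M\<^esub> g \<in> extensional (topspace M)"
        using h fg by (simp_all add: carrier_Homeo)
      fix p assume p: "p \<in> topspace M"
      have "graph_code t (point_code p) (point_code (f (g p)))"
        using R[THEN conjunct2, THEN spec[of _ "point_code p"], THEN spec[of _ "point_code (g p)"],
            THEN spec[of _ "point_code (f (g p))"]]
        by (simp add: p fM f(2) g(2) graph_code_map_code[OF c(1)] graph_code_map_code[OF c(2)])
      then show "h p = (f \<otimes>\<^bsub>Homeo M\<^esub> g) p"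
        using graph_code_map_code[OF continuous_Homeo[OF h(1)]] h(2) p fM app by simp
    qed
    then show ?L by (simp add: h)
  qed
  moreover have "r \<otimes>\<^bsub>code_group\<^esub> s = map_code (f \<otimes>\<^bsub>Homeo M\<^esub> g)"
    using f g mult_code_group by simp
  ultimately show ?thesis using True by metis
qed

section \<open>Definability of the coded notions\<close>

lemma Borel_pred_point_codes:
  assumes "Baire_term X d t"
  shows "Borel_pred X d (\<lambda>w. t w \<in> point_codes)"
  unfolding in_point_codes_iff
  by (intro Borel_pred_conj Borel_pred_disj Borel_pred_imp Borel_pred_all_countable Borel_pred_ex_countable
      Borel_pred_const Borel_pred_term_eq assms)

lemma Borel_pred_graph_code:
  assumes "Baire_term X d r" "Baire_term X d s" "Baire_term X d t"
  shows "Borel_pred X d (\<lambda>w. graph_code (r w) (s w) (t w))"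
  unfolding graph_code_def
  by (intro Borel_pred_conj Borel_pred_imp Borel_pred_all_countable Borel_pred_ex_countable
      Borel_pred_term_eq assms)

lemmas projective_pred_point_codes = projective_pred_Borel[OF Borel_pred_point_codes]
lemmas projective_pred_graph_code = projective_pred_Borel[OF Borel_pred_graph_code]

lemma projective_pred_entry:
  assumes "Baire_term X d t" "Baire_term X d v"
  shows "projective_pred X d (\<lambda>w. entry_at (t w) (v w) i)"
proof -
  have "Borel_pred X d (\<lambda>w. \<exists>m. v w i = m \<and> t w m = 1)"
    by (intro Borel_pred_ex_countable Borel_pred_conj Borel_pred_term_eq assms)
  then show ?thesis by (simp add: projective_pred_Borel entry_at_def)
qed

lemma projective_pred_pair_entry:
  assumes "Baire_term X d t" "Baire_term X d v"
  shows "projective_pred X d (\<lambda>w. pair_entry (t w) (v w))"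
proof -
  have "Borel_pred X d (\<lambda>w. \<exists>m n. v w 0 = m \<and> v w 1 = n \<and> t w (prod_encode (m, n)) = 1)"
    by (intro Borel_pred_ex_countable Borel_pred_conj Borel_pred_term_eq assms)
  then show ?thesis by (simp add: projective_pred_Borel pair_entry_def)
qed

lemma projective_pred_01:
  assumes "Baire_term X d t"
  shows "projective_pred X d (\<lambda>w. \<forall>k. t w k = 0 \<or> t w k = 1)"
  by (intro projective_pred_Borel Borel_pred_all_countable Borel_pred_disj Borel_pred_term_eq assms)

lemmas projective_pred_logic = projective_pred_conj projective_pred_disj projective_pred_not
  projective_pred_imp projective_pred_iff projective_pred_ex projective_pred_all

lemma projective_pred_continuous_code:
  assumes "Baire_term X d t"
  shows "projective_pred X d (\<lambda>w. continuous_code (t w))"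
  unfolding continuous_code_def
  by (intro projective_pred_01 projective_pred_pair_entry projective_pred_entry projective_pred_logic
      projective_pred_point_codes projective_pred_graph_code Baire_term_trunc Baire_term_last assms)

lemma projective_pred_homeo_code:
  assumes "Baire_term X d t"
  shows "projective_pred X d (\<lambda>w. homeo_code (t w))"
  unfolding homeo_code_def
  by (intro projective_pred_logic projective_pred_continuous_code
      projective_pred_point_codes projective_pred_graph_code Baire_term_trunc Baire_term_last assms)

lemma projective_structure_code_group: "projective_structure X code_group"
  unfolding projective_structure_def
proof (intro conjI allI impI)
  fix d t assume "Baire_term X d t"
  from projective_pred_homeo_code[OF this]
  show "projective_pred X d (\<lambda>w. t w \<in> carrier code_group)"
    by (simp add: homeo_code_iff code_group_def)
next
  fix d r s t assume "Baire_term X d r" "Baire_term X d s" "Baire_term X d t"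
  then show "projective_pred X d (\<lambda>w. r w \<otimes>\<^bsub>code_group\<^esub> s w = t w)"
    unfolding mult_code_group_iff
    by (intro projective_pred_logic projective_pred_homeo_code projective_pred_Borel[OF Borel_pred_eq_terms]
        projective_pred_point_codes projective_pred_graph_code Baire_term_trunc Baire_term_last)
qed

lemma sat_code_group:
  assumes "g \<in> carrier (Homeo M)"
  shows "sat code_group (\<lambda>_. map_code g) \<psi> \<longleftrightarrow> sat (Homeo M) (\<lambda>_. g) \<psi>"
proof -
  have "sat code_group (map_code \<circ> (\<lambda>_. g)) \<psi> \<longleftrightarrow> sat (Homeo M) (\<lambda>_. g) \<psi>"
  proof (rule sat_iso_image)
    interpret group "Homeo M" by (rule group_Homeo)
    show "\<one>\<^bsub>Homeo M\<^esub> \<in> carrier (Homeo M)" by simp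
    show "a \<otimes>\<^bsub>Homeo M\<^esub> b \<in> carrier (Homeo M)"
      if "a \<in> carrier (Homeo M)" "b \<in> carrier (Homeo M)" for a b using that by simp
  qed (use assms inj_map_code mult_code_group in \<open>auto simp: code_group_def\<close>)
  then show ?thesis by (simp add: o_def)
qed

text \<open>The code of \<open>g x\<close> is assumed to depend on \<open>x\<close> only in a Borel
  way, so it cannot be substituted as a continuous term. Instead it is named by a quantified
  \<open>r\<close> whose entries are pinned down one by one.\<close>

theorem projective_in_sat_Homeo:
  assumes g: "\<And>x. x \<in> topspace X \<Longrightarrow> g x \<in> carrier (Homeo M)"
    and Borel: "\<And>m n. {x \<in> topspace X. g x ` B m \<subseteq> B n} \<in> Borel_sets_in X"
  shows "projective_in X {x \<in> topspace X. sat (Homeo M) (\<lambda>_. g x) \<psi>}"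
proof (rule projective_in_of_pred)
  have entry: "Borel_pred X d (\<lambda>w. t w k = map_code (g (fst w)) k)" if t: "Baire_term X d t" for d t k
  proof -
    obtain m n where k: "prod_decode k = (m, n)" by fastforce
    have "Borel_pred X d (\<lambda>w. (t w k = 1 \<and> fst w \<in> {x \<in> topspace X. g x ` B m \<subseteq> B n}) \<or>
        (t w k = 0 \<and> \<not> fst w \<in> {x \<in> topspace X. g x ` B m \<subseteq> B n}))"
      by (intro Borel_pred_conj Borel_pred_disj Borel_pred_not Borel_pred_term_eq Borel_pred_fst t Borel)
    then show ?thesis
      unfolding Borel_pred_def
      by (rule back_subst[where P = "\<lambda>S. S \<in> Borel_sets_in (times_Baire X d)"])
        (auto simp: map_code_def k topspace_times_Baire)
  qed
  have "projective_pred X 0 (\<lambda>w. \<exists>r. (\<forall>k. r k = map_code (g (fst w)) k) \<and> sat code_group (\<lambda>_. r) \<psi>)"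
  proof (rule projective_pred_ex, rule projective_pred_conj)
    have "projective_pred X (Suc 0) (\<lambda>w. \<forall>k. snd w 0 k = map_code (g (fst w)) k)"
      by (intro projective_pred_Borel Borel_pred_all_countable entry Baire_term_last)
    then show "projective_pred X (Suc 0) (\<lambda>w. \<forall>k. snd w 0 k = map_code (g (fst (trunc 0 w))) k)"
      by (simp add: trunc_def)
    show "projective_pred X (Suc 0) (\<lambda>w. sat code_group (\<lambda>_. snd w 0) \<psi>)"
      by (rule projective_sat[OF projective_structure_code_group, where \<tau> = "\<lambda>_ w. snd w 0"])
        (rule Baire_term_last)
  qed
  then show "projective_pred X 0 (\<lambda>w. fst w \<in> {x \<in> topspace X. sat (Homeo M) (\<lambda>_. g x) \<psi>})"
  proof (rule projective_pred_cong)
    fix w assume "w \<in> topspace (times_Baire X 0)"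
    then have x: "fst w \<in> topspace X" by (auto simp: topspace_times_Baire)
    have "(\<exists>r. (\<forall>k. r k = map_code (g (fst w)) k) \<and> sat code_group (\<lambda>_. r) \<psi>)
      \<longleftrightarrow> sat code_group (\<lambda>_. map_code (g (fst w))) \<psi>"
      by (metis ext)
    then show "(\<exists>r. (\<forall>k. r k = map_code (g (fst w)) k) \<and> sat code_group (\<lambda>_. r) \<psi>)
      \<longleftrightarrow> fst w \<in> {x \<in> topspace X. sat (Homeo M) (\<lambda>_. g x) \<psi>}"
      using x sat_code_group[OF g[OF x]] by simp
  qed
qed auto

end

section \<open>A one-parameter family of homeomorphisms of the line\<close>

text \<open>
  In the coordinate \<open>u / (1 - u)\<close> on the unit interval this is multiplication by \<open>a\<close>.
\<close>

definition unit_flow :: "real \<Rightarrow> real \<Rightarrow> real" where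
  "unit_flow a u = a * u / (1 + (a - 1) * u)"

lemma unit_flow_denominator:
  fixes a u :: real
  assumes "a > 0" "0 \<le> u" "u < 1"
  shows "1 + (a - 1) * u > 0"
proof -
  have "1 + (a - 1) * u = (1 - u) + a * u" by (simp add: algebra_simps)
  moreover have "a * u \<ge> 0" using assms by simp
  ultimately show ?thesis using assms(3) by linarith
qed

lemma unit_flow_range:
  assumes "a > 0" "0 \<le> u" "u < 1"
  shows "0 \<le> unit_flow a u" "unit_flow a u < 1"
  using unit_flow_denominator[OF assms] assms by (auto simp: unit_flow_def field_simps)

lemma unit_flow_0 [simp]: "unit_flow a 0 = 0"
  by (simp add: unit_flow_def)

lemma unit_flow_1 [simp]: "unit_flow 1 u = u"
  by (simp add: unit_flow_def)

lemma unit_flow_compose: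
  assumes "a > 0" "b > 0" "0 \<le> u" "u < 1"
  shows "unit_flow a (unit_flow b u) = unit_flow (a * b) u"
proof -
  let ?D = "1 + (b - 1) * u"
  have D: "?D > 0" by (rule unit_flow_denominator) (use assms in auto)
  have E: "1 + (a * b - 1) * u > 0" by (rule unit_flow_denominator) (use assms in auto)
  have "1 + (a - 1) * unit_flow b u = (1 + (a * b - 1) * u) / ?D"
    using D by (simp add: unit_flow_def field_simps)
  then have "unit_flow a (unit_flow b u) = (a * (b * u / ?D)) / ((1 + (a * b - 1) * u) / ?D)"
    by (simp add: unit_flow_def)
  also have "\<dots> = unit_flow (a * b) u" using D E by (simp add: unit_flow_def)
  finally show ?thesis .
qed

lemma unit_flow_strict_mono:
  assumes "a > 0" "0 \<le> u" "u < v" "v < 1"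
  shows "unit_flow a u < unit_flow a v"
proof -
  have "1 + (a - 1) * u > 0" "1 + (a - 1) * v > 0"
    by (rule unit_flow_denominator; use assms in simp)+
  moreover have "a * u * (1 + (a - 1) * v) < a * v * (1 + (a - 1) * u)"
  proof -
    have "a * v * (1 + (a - 1) * u) - a * u * (1 + (a - 1) * v) = a * (v - u)" by (simp add: algebra_simps)
    moreover have "a * (v - u) > 0" using assms by simp
    ultimately show ?thesis by linarith
  qed
  ultimately show ?thesis by (simp add: unit_flow_def frac_less_eq divide_less_eq less_divide_eq field_simps)
qed

lemma unit_flow_limits:
  assumes "0 < u" "u < 1"
  shows "(\<lambda>k. unit_flow (2 ^ k) u) \<longlonglongrightarrow> 1" "(\<lambda>k. unit_flow ((1 / 2) ^ k) u) \<longlonglongrightarrow> 0"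
proof -
  have h: "(\<lambda>k. (1 / 2 :: real) ^ k) \<longlonglongrightarrow> 0" by (rule LIMSEQ_realpow_zero) auto
  have "(\<lambda>k. u / ((1 - u) * (1 / 2) ^ k + u)) \<longlonglongrightarrow> u / ((1 - u) * 0 + u)"
    by (intro tendsto_intros h) (use assms in auto)
  moreover have "u / ((1 - u) * (1 / 2) ^ k + u) = unit_flow (2 ^ k) u" for k
  proof -
    have "1 + (2 ^ k - 1) * u = 2 ^ k * ((1 - u) * (1 / 2) ^ k + u)"
      by (simp add: field_simps power_divide)
    then show ?thesis by (simp add: unit_flow_def)
  qed
  ultimately show "(\<lambda>k. unit_flow (2 ^ k) u) \<longlonglongrightarrow> 1" using assms by simp
  have "(\<lambda>k. unit_flow ((1 / 2) ^ k) u) \<longlonglongrightarrow> 0 * u / (1 + (0 - 1) * u)"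
    unfolding unit_flow_def by (intro tendsto_intros h) (use assms in auto)
  then show "(\<lambda>k. unit_flow ((1 / 2) ^ k) u) \<longlonglongrightarrow> 0" by simp
qed

text \<open>On each interval \<open>[i, i + 1)\<close> this is a scaling in the coordinate of
  \<open>unit_flow\<close>, so multipliers multiply under composition. A multiplier above 1 pushes
  towards the upper endpoint, one below 1 towards the lower.\<close>

definition line_flow :: "(int \<Rightarrow> real) \<Rightarrow> real \<Rightarrow> real" where
  "line_flow c t = of_int \<lfloor>t\<rfloor> + unit_flow (c \<lfloor>t\<rfloor>) (frac t)"

lemma floor_line_flow:
  assumes "\<And>i. c i > 0"
  shows "\<lfloor>line_flow c t\<rfloor> = \<lfloor>t\<rfloor>" "frac (line_flow c t) = unit_flow (c \<lfloor>t\<rfloor>) (frac t)"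
proof -
  note r = unit_flow_range[OF assms frac_ge_0 frac_lt_1, of "\<lfloor>t\<rfloor>" t]
  show f: "\<lfloor>line_flow c t\<rfloor> = \<lfloor>t\<rfloor>"
    unfolding line_flow_def by (rule floor_unique) (use r in linarith)+
  show "frac (line_flow c t) = unit_flow (c \<lfloor>t\<rfloor>) (frac t)"
    unfolding frac_def[of "line_flow c t"] f by (simp add: line_flow_def)
qed

lemma line_flow_compose:
  assumes "\<And>i. c i > 0" "\<And>i. c' i > 0"
  shows "line_flow c (line_flow c' t) = line_flow (\<lambda>i. c i * c' i) t"
  unfolding line_flow_def[of c] floor_line_flow[OF assms(2)]
  by (simp add: line_flow_def unit_flow_compose assms frac_lt_1)

lemma line_flow_1 [simp]: "line_flow (\<lambda>_. 1) t = t"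
  by (simp add: line_flow_def frac_def)

lemma line_flow_of_int [simp]: "line_flow c (of_int i) = of_int i"
  by (simp add: line_flow_def)

lemma line_flow_power:
  assumes "\<And>i. c i > 0"
  shows "(line_flow c ^^ k) t = line_flow (\<lambda>i. c i ^ k) t"
proof (induction k)
  case (Suc k)
  then show ?case using assms by (simp add: line_flow_compose)
qed simp

lemma line_flow_inverse:
  assumes "\<And>i. c i > 0"
  shows "line_flow c \<circ> line_flow (\<lambda>i. inverse (c i)) = id" "line_flow (\<lambda>i. inverse (c i)) \<circ> line_flow c = id"
proof -
  have [simp]: "c i \<noteq> 0" for i using assms[of i] by simp
  show "line_flow c \<circ> line_flow (\<lambda>i. inverse (c i)) = id" "line_flow (\<lambda>i. inverse (c i)) \<circ> line_flow c = id"
    using assms by (auto simp: line_flow_compose fun_eq_iff)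
qed

lemma strict_mono_line_flow:
  assumes c: "\<And>i. c i > 0"
  shows "strict_mono (line_flow c)"
proof (rule strict_monoI)
  fix s t :: real assume st: "s < t"
  show "line_flow c s < line_flow c t"
  proof (cases "\<lfloor>s\<rfloor> = \<lfloor>t\<rfloor>")
    case True
    then have "frac s < frac t" using st by (simp add: frac_def)
    then show ?thesis
      using True unit_flow_strict_mono[OF c frac_ge_0 _ frac_lt_1] by (simp add: line_flow_def)
  next
    case False
    then have "\<lfloor>s\<rfloor> + 1 \<le> \<lfloor>t\<rfloor>" using st floor_mono[of s t] by linarith
    then have "of_int \<lfloor>s\<rfloor> + 1 \<le> (of_int \<lfloor>t\<rfloor> :: real)" by linarith
    then show ?thesis
      using unit_flow_range[OF c frac_ge_0 frac_lt_1, of "\<lfloor>s\<rfloor>" s]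
        unit_flow_range[OF c frac_ge_0 frac_lt_1, of "\<lfloor>t\<rfloor>" t]
      unfolding line_flow_def by linarith
  qed
qed

lemma surj_line_flow: "(\<And>i. c i > 0) \<Longrightarrow> surj (line_flow c)"
  using line_flow_inverse(1)[of c] by (metis comp_surj fun.map_id0 surj_def surj_id comp_apply id_apply)

text \<open>Source of the invariance under \<open>\<theta>\<close>: conjugation by the unit
  translation moves the weights by one place.\<close>

lemma line_flow_shift:
  "line_flow (\<lambda>i. c (i + 1)) t + 1 = line_flow c (t + 1)"
  by (simp add: line_flow_def frac_def)

lemma line_flow_limits:
  assumes "t \<notin> \<int>" "\<And>i. c i > 0"
  shows "c \<lfloor>t\<rfloor> = 2 \<Longrightarrow> (\<lambda>k. (line_flow c ^^ k) t) \<longlonglongrightarrow> of_int (\<lfloor>t\<rfloor> + 1)"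
    and "c \<lfloor>t\<rfloor> = 1 / 2 \<Longrightarrow> (\<lambda>k. (line_flow c ^^ k) t) \<longlonglongrightarrow> of_int \<lfloor>t\<rfloor>"
proof -
  have u: "0 < frac t" "frac t < 1" using assms(1) by (auto simp: frac_lt_1 frac_gt_0_iff)
  have *: "(line_flow c ^^ k) t = of_int \<lfloor>t\<rfloor> + unit_flow (c \<lfloor>t\<rfloor> ^ k) (frac t)" for k
    by (simp add: line_flow_power assms(2)) (simp add: line_flow_def)
  show "(\<lambda>k. (line_flow c ^^ k) t) \<longlonglongrightarrow> of_int (\<lfloor>t\<rfloor> + 1)" if "c \<lfloor>t\<rfloor> = 2"
    using tendsto_add[OF tendsto_const unit_flow_limits(1)[OF u], of "of_int \<lfloor>t\<rfloor>"] by (simp add: * that)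
  show "(\<lambda>k. (line_flow c ^^ k) t) \<longlonglongrightarrow> of_int \<lfloor>t\<rfloor>" if "c \<lfloor>t\<rfloor> = 1 / 2"
    using tendsto_add[OF tendsto_const unit_flow_limits(2)[OF u], of "of_int \<lfloor>t\<rfloor>"] by (simp add: * that)
qed

section \<open>Transport to the shell between radius 1 and radius 2\<close>

text \<open>The logistic function moved up by 1; \<open>shell_coord\<close> is the corresponding
  logit.\<close>

definition shell_radius :: "real \<Rightarrow> real" where
  "shell_radius t = 1 + 1 / (1 + exp (- t))"

definition shell_coord :: "real \<Rightarrow> real" where
  "shell_coord r = ln ((r - 1) / (2 - r))"

definition radius_map :: "(real \<Rightarrow> real) \<Rightarrow> real \<Rightarrow> real" where
  "radius_map f r = (if 1 < r \<and> r < 2 then shell_radius (f (shell_coord r)) else r)"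

lemma shell_radius_bounds: "1 < shell_radius t" "shell_radius t < 2"
proof -
  define e where "e = exp (- t)"
  have "e > 0" by (simp add: e_def)
  then show "1 < shell_radius t" "shell_radius t < 2"
    by (simp_all add: shell_radius_def divide_less_eq add_pos_pos flip: e_def)
qed

lemma shell_coord_radius [simp]: "shell_coord (shell_radius t) = t"
proof -
  define e where "e = exp (- t)"
  have e: "e > 0" by (simp add: e_def)
  have "(shell_radius t - 1) / (2 - shell_radius t) = 1 / e"
    unfolding shell_radius_def e_def[symmetric] using e by (simp add: field_simps)
  also have "\<dots> = exp t" by (simp add: e_def exp_minus divide_inverse)
  finally show ?thesis by (simp add: shell_coord_def)
qed

lemma shell_radius_coord: "1 < r \<Longrightarrow> r < 2 \<Longrightarrow> shell_radius (shell_coord r) = r"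
  by (simp add: shell_radius_def shell_coord_def exp_minus field_simps)

lemma shell_radius_strict_mono: "s < t \<Longrightarrow> shell_radius s < shell_radius t"
proof -
  assume "s < t"
  then have "1 + exp (- t) < 1 + exp (- s)" by simp
  moreover have "0 < 1 + exp (- t)" "0 < 1 + exp (- s)" by (simp_all add: add_pos_pos)
  ultimately have "1 / (1 + exp (- s)) < 1 / (1 + exp (- t))"
    by (intro divide_strict_left_mono mult_pos_pos) auto
  then show ?thesis by (simp add: shell_radius_def)
qed

lemma shell_coord_strict_mono:
  assumes "1 < r" "r < s" "s < 2"
  shows "shell_coord r < shell_coord s"
proof (rule ccontr)
  assume "\<not> ?thesis"
  then have "shell_radius (shell_coord s) \<le> shell_radius (shell_coord r)"
    using shell_radius_strict_mono[of "shell_coord s" "shell_coord r"] by fastforce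
  then show False using assms by (simp add: shell_radius_coord)
qed

lemma radius_map_compose: "radius_map f (radius_map g r) = radius_map (f \<circ> g) r"
  using shell_radius_bounds by (simp add: radius_map_def)

lemma radius_map_id [simp]: "radius_map id r = r"
  by (simp add: radius_map_def shell_radius_coord)

lemma radius_map_shell_radius [simp]: "radius_map f (shell_radius t) = shell_radius (f t)"
  using shell_radius_bounds by (simp add: radius_map_def)

lemma radius_map_outside: "r \<le> 1 \<or> 2 \<le> r \<Longrightarrow> radius_map f r = r"
  by (auto simp: radius_map_def)

lemma radius_map_bounds:
  "1 \<le> r \<Longrightarrow> 1 \<le> radius_map f r" "r < 2 \<Longrightarrow> radius_map f r < 2"
  using shell_radius_bounds less_imp_le by (auto simp: radius_map_def)

lemma strict_mono_radius_map:
  assumes "strict_mono f"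
  shows "strict_mono (radius_map f)"
proof (rule strict_monoI)
  fix r s :: real assume "r < s"
  then show "radius_map f r < radius_map f s"
    using shell_radius_bounds[of "f (shell_coord r)"] shell_radius_bounds[of "f (shell_coord s)"]
      shell_radius_strict_mono[OF strict_monoD[OF assms shell_coord_strict_mono[of r s]]]
    by (auto simp: radius_map_def)
qed

text \<open>The increasing homeomorphisms of the line; continuity is automatic for monotone
  surjections.\<close>

definition line_homeos :: "(real \<Rightarrow> real) set" where
  "line_homeos = {f. strict_mono f \<and> surj f}"

lemma line_homeos_inv:
  assumes "f \<in> line_homeos"
  shows "inv_into UNIV f \<in> line_homeos" "f \<circ> inv_into UNIV f = id" "inv_into UNIV f \<circ> f = id"
proof -
  have f: "strict_mono f" "surj f" "inj f"
    using assms strict_mono_imp_inj_on by (auto simp: line_homeos_def)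
  show "f \<circ> inv_into UNIV f = id" "inv_into UNIV f \<circ> f = id" using f by (auto simp: surj_iff)
  have "strict_mono (inv_into UNIV f)"
    using strict_mono_inv_on_range[OF f(1)] f(2) by (simp add: strict_mono_on_def strict_mono_def)
  then show "inv_into UNIV f \<in> line_homeos" using f by (simp add: line_homeos_def inj_imp_surj_inv)
qed

lemma line_flow_in_line_homeos: "(\<And>i. c i > 0) \<Longrightarrow> line_flow c \<in> line_homeos"
  by (simp add: line_homeos_def strict_mono_line_flow surj_line_flow)

lemma translation_in_line_homeos: "(\<lambda>t. t + 1) \<in> line_homeos"
  by (auto simp: line_homeos_def strict_mono_def intro!: surjI[of _ "\<lambda>t. t - 1"])

text \<open>A monotone function with open range is continuous, so no limits at the radii 1 and 2
  have to be computed.\<close>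

lemma continuous_on_radius_map:
  assumes "f \<in> line_homeos"
  shows "continuous_on UNIV (radius_map f)"
proof (rule continuous_onI_mono)
  have "radius_map f (radius_map (inv_into UNIV f) r) = r" for r
    by (simp add: radius_map_compose line_homeos_inv[OF assms])
  then have "surj (radius_map f)" by (metis surjI)
  then show "open (range (radius_map f))" by simp
  show "radius_map f r \<le> radius_map f s" if "r \<le> s" for r s
    using strict_mono_radius_map[of f] assms that strict_mono_less_eq by (auto simp: line_homeos_def)
qed

section \<open>Homeomorphisms supported in a chart\<close>

text \<open>A scaled sum norm centred at \<open>v\<close>. It is homogeneous along rays and has
  compact balls, and \<open>K\<close> shrinks the ball of radius 2 until it fits into the
  chart.\<close>

definition shell_norm :: "nat \<Rightarrow> (nat \<Rightarrow> real) \<Rightarrow> real \<Rightarrow> (nat \<Rightarrow> real) \<Rightarrow> real" where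
  "shell_norm n v K x = K * (\<Sum>i<n. \<bar>x i - v i\<bar>)"

lemma shell_norm_coord_le:
  assumes "K > 0" "i < n"
  shows "\<bar>x i - v i\<bar> \<le> shell_norm n v K x / K"
proof -
  have "\<bar>x i - v i\<bar> \<le> (\<Sum>i<n. \<bar>x i - v i\<bar>)"
    by (rule member_le_sum) (use assms in auto)
  then show ?thesis using assms by (simp add: shell_norm_def)
qed

lemma continuous_map_shell_norm: "continuous_map (powertop_real UNIV) euclideanreal (shell_norm n v K)"
proof -
  have "continuous_map (powertop_real UNIV) euclideanreal (\<lambda>x. K * (\<Sum>i<n. \<bar>x i - v i\<bar>))"
    by (intro continuous_map_real_mult continuous_map_sum continuous_map_real_abs continuous_map_diff
        continuous_map_product_projection) auto
  then show ?thesis by (simp add: shell_norm_def[abs_def])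
qed

text \<open>The ball is a closed subset of a product of compact intervals, degenerate from
  coordinate \<open>n\<close> on.\<close>

lemma compactin_shell_norm_ball:
  assumes K: "K > 0"
  shows "compactin (Euclidean_space n) {x \<in> topspace (Euclidean_space n). shell_norm n v K x \<le> 2}"
proof -
  let ?S = "PiE UNIV (\<lambda>i. if i < n then {v i - 2 / K..v i + 2 / K} else {0 :: real})"
  have "compactin (powertop_real UNIV) ?S" by (simp add: compactin_PiE)
  moreover have "closedin (powertop_real UNIV) {x \<in> topspace (powertop_real UNIV). shell_norm n v K x \<in> {..2}}"
    by (rule closedin_continuous_map_preimage[OF continuous_map_shell_norm]) simp
  ultimately have "compactin (powertop_real UNIV)
      ({x \<in> topspace (powertop_real UNIV). shell_norm n v K x \<in> {..2}} \<inter> ?S)"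
    by (rule closed_Int_compactin[rotated])
  moreover have "{x \<in> topspace (powertop_real UNIV). shell_norm n v K x \<in> {..2}} \<inter> ?S
      = {x \<in> topspace (Euclidean_space n). shell_norm n v K x \<le> 2}" (is "?L = ?R")
  proof (rule Set.set_eqI)
    fix x
    show "x \<in> ?L \<longleftrightarrow> x \<in> ?R"
    proof
      assume "x \<in> ?L"
      then have N: "shell_norm n v K x \<le> 2" and "x \<in> ?S" by auto
      from PiE_mem[OF this(2)] have S: "x i \<in> (if i < n then {v i - 2 / K..v i + 2 / K} else {0})" for i
        by simp
      have "x i = 0" if "i \<ge> n" for i using S[of i] that by simp
      then show "x \<in> ?R" using N by (simp add: topspace_Euclidean_space)
    next
      assume x: "x \<in> ?R"
      have "x i \<in> {v i - 2 / K..v i + 2 / K}" if "i < n" for i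
      proof -
        have "shell_norm n v K x / K \<le> 2 / K" using x K by (simp add: divide_right_mono)
        then have "\<bar>x i - v i\<bar> \<le> 2 / K" using shell_norm_coord_le[OF K that, of x v] by linarith
        then show ?thesis by auto
      qed
      then show "x \<in> ?L" using x by (auto simp: topspace_Euclidean_space PiE_iff)
    qed
  qed
  ultimately show ?thesis
    unfolding Euclidean_space_def by (simp add: compactin_subtopology) auto
qed

lemma shell_norm_ball_in_open:
  assumes V: "openin (Euclidean_space n) V" and v: "v \<in> V"
  obtains K where "K > 0" "\<And>x. x \<in> topspace (Euclidean_space n) \<Longrightarrow> shell_norm n v K x \<le> 2 \<Longrightarrow> x \<in> V"
proof -
  obtain W where W: "openin (powertop_real UNIV) W" "V = W \<inter> {x. \<forall>i\<ge>n. x i = 0}"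
    using V unfolding Euclidean_space_def openin_subtopology by blast
  obtain U where U: "\<And>i. open (U i)" "v \<in> PiE UNIV U" "PiE UNIV U \<subseteq> W"
  proof -
    have "v \<in> W" using W v by simp
    with W(1) have "\<exists>U. (\<forall>i. open (U i)) \<and> v \<in> PiE UNIV U \<and> PiE UNIV U \<subseteq> W"
      unfolding openin_product_topology_alt by simp blast
    then show thesis using that by blast
  qed
  have "\<exists>e>0. ball (v i) e \<subseteq> U i" for i
    using U open_contains_ball by (metis PiE_mem UNIV_I)
  then obtain e where e: "\<And>i. e i > 0" "\<And>i. ball (v i) (e i) \<subseteq> U i" by metis
  \<comment> \<open>The inserted 1 keeps the set nonempty even for \<open>n = 0\<close>.\<close>
  define d where "d = Min (insert 1 (e ` {..<n}))"
  have d: "d > 0" "\<And>i. i < n \<Longrightarrow> d \<le> e i" using e by (auto simp: d_def)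
  show thesis
  \<comment> \<open>With this factor, norm at most 2 bounds each coordinate difference by
    \<open>2 * d / 3\<close>, strictly below the radii \<open>e i\<close> for
    \<open>i < n\<close>.\<close>
  proof (rule that[of "3 / d"])
    show "3 / d > 0" using d by simp
    fix x assume x: "x \<in> topspace (Euclidean_space n)" "shell_norm n v (3 / d) x \<le> 2"
    have "x i \<in> U i" for i
    proof (cases "i < n")
      case True
      have "\<bar>x i - v i\<bar> \<le> shell_norm n v (3 / d) x / (3 / d)"
        by (rule shell_norm_coord_le) (use d True in auto)
      also have "\<dots> \<le> 2 / (3 / d)" by (rule divide_right_mono) (use x d in auto)
      also have "\<dots> < e i" using d(1) d(2)[OF True] by simp
      finally have "x i \<in> ball (v i) (e i)" by (simp add: dist_real_def abs_minus_commute)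
      then show ?thesis using e by blast
    next
      case False
      then have "x i = v i" using x v W by (auto simp: topspace_Euclidean_space)
      then show ?thesis using U(2) by (auto simp: PiE_iff)
    qed
    then show "x \<in> V" using U(3) x W by (auto simp: PiE_iff topspace_Euclidean_space)
  qed
qed

text \<open>Clamping the radius at 1 avoids division by zero at the centre and keeps the factor
  continuous; inside radius 1 its value is 1, as \<open>radius_map f\<close> fixes 1.\<close>

definition radial_factor :: "(real \<Rightarrow> real) \<Rightarrow> real \<Rightarrow> real" where
  "radial_factor f r = radius_map f (max 1 r) / max 1 r"

definition radial_map :: "nat \<Rightarrow> (nat \<Rightarrow> real) \<Rightarrow> real \<Rightarrow> (real \<Rightarrow> real) \<Rightarrow> (nat \<Rightarrow> real) \<Rightarrow> nat \<Rightarrow> real" where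
  "radial_map n v K f x = (\<lambda>i. v i + radial_factor f (shell_norm n v K x) * (x i - v i))"

lemma radial_factor_nonneg: "radial_factor f r \<ge> 0"
proof -
  have "radius_map f (max 1 r) \<ge> 1" by (rule radius_map_bounds) simp
  then show ?thesis by (simp add: radial_factor_def)
qed

lemma radial_factor_mult: "r \<ge> 0 \<Longrightarrow> radial_factor f r * r = radius_map f r"
  by (cases "r \<ge> 1") (simp_all add: radial_factor_def radius_map_outside max_def)

lemma radial_factor_outside: "r \<le> 1 \<or> 2 \<le> r \<Longrightarrow> radial_factor f r = 1"
  by (auto simp: radial_factor_def radius_map_outside max_def)

lemma radial_factor_compose:
  assumes "r \<ge> 0"
  shows "radial_factor f (radius_map g r) * radial_factor g r = radial_factor (f \<circ> g) r"
proof (cases "r \<ge> 1")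
  case True
  then have "radius_map g r \<ge> 1" by (rule radius_map_bounds)
  then show ?thesis using True by (simp add: radial_factor_def max_def radius_map_compose)
next
  case False
  then show ?thesis by (simp add: radial_factor_outside radius_map_outside)
qed

lemma shell_norm_nonneg: "K > 0 \<Longrightarrow> shell_norm n v K x \<ge> 0"
  by (simp add: shell_norm_def sum_nonneg)

lemma shell_norm_scale:
  "shell_norm n v K (\<lambda>i. v i + c * (x i - v i)) = \<bar>c\<bar> * shell_norm n v K x"
  by (simp add: shell_norm_def abs_mult flip: sum_distrib_left)

lemma shell_norm_radial_map:
  assumes "K > 0"
  shows "shell_norm n v K (radial_map n v K f x) = radius_map f (shell_norm n v K x)"
  unfolding radial_map_def shell_norm_scale
  by (simp add: abs_of_nonneg[OF radial_factor_nonneg] radial_factor_mult shell_norm_nonneg assms)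

text \<open>The factors form a cocycle over \<open>radius_map\<close>, since the norm of the image
  of a point is \<open>radius_map\<close> of its norm.\<close>

lemma radial_map_compose:
  assumes "K > 0"
  shows "radial_map n v K f (radial_map n v K g x) = radial_map n v K (f \<circ> g) x"
  unfolding radial_map_def[of n v K f] shell_norm_radial_map[OF assms]
  using radial_factor_compose[OF shell_norm_nonneg[OF assms], of f g n v x]
  by (simp add: radial_map_def fun_eq_iff mult.assoc[symmetric])

lemma radial_map_outside:
  "shell_norm n v K x \<le> 1 \<or> 2 \<le> shell_norm n v K x \<Longrightarrow> radial_map n v K f x = x"
  by (simp add: radial_map_def radial_factor_outside)

lemma radial_map_id [simp]: "radial_map n v K id x = x"
proof -
  have "max 1 r \<noteq> 0" for r :: real by (simp add: max_def)
  then show ?thesis by (simp add: radial_map_def radial_factor_def)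
qed

lemma radial_map_in_Euclidean_space:
  "v \<in> topspace (Euclidean_space n) \<Longrightarrow> x \<in> topspace (Euclidean_space n) \<Longrightarrow>
    radial_map n v K f x \<in> topspace (Euclidean_space n)"
  by (simp add: topspace_Euclidean_space radial_map_def)

lemma continuous_map_radial_map:
  assumes f: "f \<in> line_homeos" and v: "v \<in> topspace (Euclidean_space n)"
  shows "continuous_map (Euclidean_space n) (Euclidean_space n) (radial_map n v K f)"
proof -
  have "continuous_on UNIV (radial_factor f)"
    unfolding radial_factor_def[abs_def]
    by (intro continuous_intros continuous_on_compose2[OF continuous_on_radius_map[OF f]]) auto
  then have m: "continuous_map euclideanreal euclideanreal (radial_factor f)" by simp
  have N: "continuous_map (Euclidean_space n) euclideanreal (shell_norm n v K)"
    unfolding Euclidean_space_def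
    by (rule continuous_map_from_subtopology[OF continuous_map_shell_norm])
  have co: "continuous_map (Euclidean_space n) euclideanreal (\<lambda>x. x i)" for i
    unfolding Euclidean_space_def
    by (intro continuous_map_from_subtopology continuous_map_product_projection) simp
  have mN: "continuous_map (Euclidean_space n) euclideanreal (\<lambda>x. radial_factor f (shell_norm n v K x))"
    using continuous_map_compose[OF N m] by (simp add: o_def)
  have "continuous_map (Euclidean_space n) euclideanreal (\<lambda>x. radial_map n v K f x i)" for i
    unfolding radial_map_def
    by (intro continuous_map_add continuous_map_real_mult continuous_map_diff mN co) auto
  then have "continuous_map (Euclidean_space n) (powertop_real UNIV) (radial_map n v K f)"
    by (simp add: continuous_map_componentwise_UNIV)
  moreover have "radial_map n v K f \<in> topspace (Euclidean_space n) \<rightarrow> {x. \<forall>i\<ge>n. x i = 0}"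
    using radial_map_in_Euclidean_space[OF v] by (auto simp: topspace_Euclidean_space)
  ultimately show ?thesis
    using continuous_map_in_subtopology[of "Euclidean_space n" "powertop_real UNIV" "{x. \<forall>i\<ge>n. x i = 0}"]
    unfolding Euclidean_space_def by blast
qed

locale charted_shell =
  fixes M :: "'a topology" and U :: "'a set" and n :: nat and V :: "(nat \<Rightarrow> real) set"
    and \<psi> :: "'a \<Rightarrow> nat \<Rightarrow> real" and \<psi>' :: "(nat \<Rightarrow> real) \<Rightarrow> 'a" and v :: "nat \<Rightarrow> real" and K :: real
  assumes Hausdorff: "Hausdorff_space M"
    and n_pos: "n > 0"
    and open_U: "openin M U"
    and open_V: "openin (Euclidean_space n) V"
    and chart: "homeomorphic_maps (subtopology M U) (subtopology (Euclidean_space n) V) \<psi> \<psi>'"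
    and v_in_V: "v \<in> V"
    and K_pos: "K > 0"
    and ball_in_V: "x \<in> topspace (Euclidean_space n) \<Longrightarrow> shell_norm n v K x \<le> 2 \<Longrightarrow> x \<in> V"
begin

abbreviation "E \<equiv> Euclidean_space n"
abbreviation "N \<equiv> shell_norm n v K"

lemma U_subset: "U \<subseteq> topspace M" and V_subset: "V \<subseteq> topspace E"
  using open_U open_V openin_subset by blast+

lemma v_in_E: "v \<in> topspace E"
  using v_in_V V_subset by blast

lemma chart_simps:
  "p \<in> U \<Longrightarrow> \<psi> p \<in> V" "p \<in> U \<Longrightarrow> \<psi>' (\<psi> p) = p" "x \<in> V \<Longrightarrow> \<psi>' x \<in> U" "x \<in> V \<Longrightarrow> \<psi> (\<psi>' x) = x"
  using chart U_subset V_subset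
  by (auto simp: homeomorphic_maps_def continuous_map_def Pi_iff Int_absorb1)

lemma continuous_charts:
  "continuous_map (subtopology M U) (subtopology E V) \<psi>"
  "continuous_map (subtopology E V) (subtopology M U) \<psi>'"
  using chart by (auto simp: homeomorphic_maps_def)

definition shell_map :: "(real \<Rightarrow> real) \<Rightarrow> 'a \<Rightarrow> 'a" where
  "shell_map f = (\<lambda>p\<in>topspace M. if p \<in> U then \<psi>' (radial_map n v K f (\<psi> p)) else p)"

lemma radial_map_in_V:
  assumes "x \<in> V"
  shows "radial_map n v K f x \<in> V"
proof (cases "N x < 2")
  case True
  then have "N (radial_map n v K f x) < 2"
    by (simp add: shell_norm_radial_map K_pos radius_map_bounds)
  then show ?thesis
    using radial_map_in_Euclidean_space[OF v_in_E] assms V_subset ball_in_V by (meson less_imp_le subsetD)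
next
  case False
  then show ?thesis using assms by (simp add: radial_map_outside)
qed

lemma shell_map_U: "p \<in> U \<Longrightarrow> shell_map f p = \<psi>' (radial_map n v K f (\<psi> p))"
  using U_subset by (auto simp: shell_map_def)

lemma shell_map_not_U: "p \<in> topspace M \<Longrightarrow> p \<notin> U \<Longrightarrow> shell_map f p = p"
  by (simp add: shell_map_def)

lemma shell_map_in_M: "p \<in> topspace M \<Longrightarrow> shell_map f p \<in> topspace M"
  using chart_simps radial_map_in_V U_subset by (auto simp: shell_map_def)

lemma shell_map_compose: "p \<in> topspace M \<Longrightarrow> shell_map f (shell_map g p) = shell_map (f \<circ> g) p"
  using chart_simps radial_map_in_V K_pos
  by (cases "p \<in> U") (simp_all add: shell_map_U shell_map_not_U radial_map_compose)

lemma shell_map_id: "p \<in> topspace M \<Longrightarrow> shell_map id p = p"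
  using chart_simps by (cases "p \<in> U") (simp_all add: shell_map_U shell_map_not_U)

text \<open>Pasting over two open sets: \<open>U\<close>, and the complement of the image of the
  ball of radius 2. That image is closed because it is compact and \<open>M\<close> is Hausdorff,
  and on the overlap the map is the identity.\<close>

lemma continuous_map_shell_map:
  assumes f: "f \<in> line_homeos"
  shows "continuous_map M M (shell_map f)"
proof -
  let ?B = "{x \<in> topspace E. N x \<le> 2}"
  have "compactin E ?B" by (rule compactin_shell_norm_ball[OF K_pos])
  then have "compactin (subtopology E V) ?B" using ball_in_V by (auto simp: compactin_subtopology)
  then have "compactin (subtopology M U) (\<psi>' ` ?B)" by (rule image_compactin[OF _ continuous_charts(2)])
  then have "closedin M (\<psi>' ` ?B)"
    using compactin_imp_closedin[OF Hausdorff] by (simp add: compactin_subtopology)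
  then have open_B: "openin M (topspace M - \<psi>' ` ?B)" by blast
  define g where "g b = (if b then \<lambda>p. \<psi>' (radial_map n v K f (\<psi> p)) else id)" for b
  show ?thesis
  proof (rule pasting_lemma[where I = UNIV and T = "\<lambda>b. if b then U else topspace M - \<psi>' ` ?B" and f = g])
    show "openin M (if b then U else topspace M - \<psi>' ` ?B)" for b
      using open_U open_B by simp
    have "continuous_map (subtopology E V) (subtopology E V) (radial_map n v K f)"
      using continuous_map_from_subtopology[OF continuous_map_radial_map[OF f v_in_E]]
      by (rule continuous_map_into_subtopology) (use radial_map_in_V in auto)
    from continuous_map_compose[OF continuous_map_compose[OF continuous_charts(1) this] continuous_charts(2)]
    have "continuous_map (subtopology M U) (subtopology M U) (\<lambda>p. \<psi>' (radial_map n v K f (\<psi> p)))"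
      by (simp add: o_def)
    then have "continuous_map (subtopology M U) M (\<lambda>p. \<psi>' (radial_map n v K f (\<psi> p)))"
      by (rule continuous_map_into_fulltopology)
    then show "continuous_map (subtopology M (if b then U else topspace M - \<psi>' ` ?B)) M (g b)" for b
      by (simp add: g_def continuous_map_from_subtopology)
    have far: "\<psi>' (radial_map n v K f (\<psi> p)) = p" if "p \<in> U" "p \<notin> \<psi>' ` ?B" for p
    proof -
      have "N (\<psi> p) > 2"
      proof (rule ccontr)
        assume "\<not> N (\<psi> p) > 2"
        then have "\<psi> p \<in> ?B" using chart_simps(1)[OF that(1)] V_subset by auto
        then have "\<psi>' (\<psi> p) \<in> \<psi>' ` ?B" by (rule imageI)
        then show False using that chart_simps(2) by simp
      qed
      then have "radial_map n v K f (\<psi> p) = \<psi> p" by (intro radial_map_outside) simp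
      then show ?thesis using chart_simps(2)[OF that(1)] by simp
    qed
    show "g b p = g b' p"
      if "p \<in> topspace M \<inter> (if b then U else topspace M - \<psi>' ` ?B) \<inter> (if b' then U else topspace M - \<psi>' ` ?B)"
      for b b' p
      using that far[of p] by (cases b; cases b') (auto simp: g_def)
    show "\<exists>b. b \<in> UNIV \<and> p \<in> (if b then U else topspace M - \<psi>' ` ?B) \<and> shell_map f p = g b p"
      if "p \<in> topspace M" for p
    proof (cases "p \<in> U")
      case True
      then show ?thesis by (intro exI[of _ True]) (simp add: g_def shell_map_U)
    next
      case False
      moreover have "\<psi>' ` ?B \<subseteq> U" using chart_simps ball_in_V by auto
      ultimately show ?thesis using that by (intro exI[of _ False]) (auto simp: g_def shell_map_not_U)
    qed
  qed
qed

lemma shell_map_in_Homeo: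
  assumes f: "f \<in> line_homeos"
  shows "shell_map f \<in> carrier (Homeo M)"
proof -
  have "homeomorphic_maps M M (shell_map f) (shell_map (inv_into UNIV f))"
    unfolding homeomorphic_maps_def
    using continuous_map_shell_map[OF f] continuous_map_shell_map[OF line_homeos_inv(1)[OF f]]
    by (simp add: shell_map_compose line_homeos_inv[OF f] shell_map_id)
  then have "homeomorphic_map M M (shell_map f)" using homeomorphic_map_maps by blast
  then show ?thesis by (simp add: Homeo_def shell_map_def)
qed

section \<open>Polar coordinates in the shell\<close>

definition direction :: "(nat \<Rightarrow> real) \<Rightarrow> bool" where
  "direction d \<longleftrightarrow> (\<forall>i\<ge>n. d i = 0) \<and> K * (\<Sum>i<n. \<bar>d i\<bar>) = 1"

text \<open>The parameter is the logit of the radius, so \<open>ray d\<close> runs over the whole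
  line between the spheres of radius 1 and 2 and \<open>shell_map f\<close> acts on it as
  \<open>f\<close>.\<close>

definition ray :: "(nat \<Rightarrow> real) \<Rightarrow> real \<Rightarrow> 'a" where
  "ray d t = \<psi>' (\<lambda>i. v i + shell_radius t * d i)"

lemma direction_exists: "\<exists>d. direction d"
proof
  have "(\<Sum>i<n. \<bar>if i = 0 then 1 / K else 0\<bar>) = (\<Sum>i<n. if i = 0 then 1 / K else 0)"
    using K_pos by (intro sum.cong) auto
  also have "\<dots> = 1 / K" using n_pos by (simp add: sum.delta)
  finally show "direction (\<lambda>i. if i = 0 then 1 / K else 0)"
    using K_pos n_pos by (simp add: direction_def)
qed

lemma ray_chart:
  assumes "direction d"
  shows "N (\<lambda>i. v i + r * d i) = \<bar>r\<bar>" "(\<lambda>i. v i + shell_radius t * d i) \<in> V"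
proof -
  have "N (\<lambda>i. v i + r * d i) = \<bar>r\<bar> * (K * (\<Sum>i<n. \<bar>d i\<bar>))" for r
    by (simp add: shell_norm_def abs_mult sum_distrib_left algebra_simps)
  then show *: "N (\<lambda>i. v i + r * d i) = \<bar>r\<bar>" for r using assms by (simp add: direction_def)
  have "(\<lambda>i. v i + shell_radius t * d i) \<in> topspace E"
    using v_in_E assms by (simp add: topspace_Euclidean_space direction_def)
  then show "(\<lambda>i. v i + shell_radius t * d i) \<in> V"
    by (rule ball_in_V) (use shell_radius_bounds[of t] * in auto)
qed

lemma ray_in_U: "direction d \<Longrightarrow> ray d t \<in> U"
  unfolding ray_def by (rule chart_simps(3)[OF ray_chart(2)])

lemma shell_map_ray:
  assumes d: "direction d"
  shows "shell_map f (ray d t) = ray d (f t)"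
proof -
  have r: "1 < shell_radius t" "shell_radius t < 2" by (rule shell_radius_bounds)+
  have "radial_factor f (shell_radius t) = shell_radius (f t) / shell_radius t"
    using r by (simp add: radial_factor_def max_def)
  then have "radial_map n v K f (\<lambda>i. v i + shell_radius t * d i) = (\<lambda>i. v i + shell_radius (f t) * d i)"
    using r by (simp add: radial_map_def ray_chart(1)[OF d])
  then show ?thesis
    using shell_map_U[OF ray_in_U[OF d]] chart_simps(4)[OF ray_chart(2)[OF d]] by (simp add: ray_def)
qed

lemma shell_map_cases:
  assumes "p \<in> topspace M"
  obtains d t where "direction d" "p = ray d t" | "\<And>f. shell_map f p = p" "\<And>d t. direction d \<Longrightarrow> p \<noteq> ray d t"
proof (cases "p \<in> U \<and> 1 < N (\<psi> p) \<and> N (\<psi> p) < 2")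
  case True
  define r where "r = N (\<psi> p)"
  define d where "d i = (\<psi> p i - v i) / r" for i
  have r: "1 < r" "r < 2" using True by (auto simp: r_def)
  have "\<psi> p \<in> topspace E" using True chart_simps V_subset by auto
  moreover have "K * (\<Sum>i<n. \<bar>d i\<bar>) = N (\<psi> p) / r"
    using r by (simp add: d_def shell_norm_def flip: sum_divide_distrib)
  ultimately have "direction d"
    using v_in_E r by (simp add: direction_def d_def topspace_Euclidean_space flip: r_def)
  moreover have "p = ray d (shell_coord r)"
    unfolding ray_def using r True by (simp add: shell_radius_coord d_def chart_simps)
  ultimately show thesis by (rule that(1))
next
  case False
  have "shell_map f p = p" for f
  proof (cases "p \<in> U")
    case True
    then have "radial_map n v K f (\<psi> p) = \<psi> p" using False by (intro radial_map_outside) linarith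
    then show ?thesis using True chart_simps by (simp add: shell_map_U)
  qed (simp add: shell_map_not_U assms)
  moreover have "p \<noteq> ray d t" if d: "direction d" for d t
  proof
    assume "p = ray d t"
    then have "\<psi> p = (\<lambda>i. v i + shell_radius t * d i)" "p \<in> U"
      using chart_simps(4)[OF ray_chart(2)[OF d]] ray_in_U[OF d] by (auto simp: ray_def)
    then show False using False ray_chart(1)[OF d] shell_radius_bounds[of t] by auto
  qed
  ultimately show thesis by (rule that(2))
qed

lemma ray_inj:
  assumes d: "direction d" "direction d'" and eq: "ray d t = ray d' t'"
  shows "d = d' \<and> t = t'"
proof -
  have x: "(\<lambda>i. v i + shell_radius t * d i) = (\<lambda>i. v i + shell_radius t' * d' i)"
    using eq chart_simps(4)[OF ray_chart(2)[OF d(1)]] chart_simps(4)[OF ray_chart(2)[OF d(2)]]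
    unfolding ray_def by metis
  then have "\<bar>shell_radius t\<bar> = \<bar>shell_radius t'\<bar>"
    using ray_chart(1)[OF d(1)] ray_chart(1)[OF d(2)] by metis
  then have r: "shell_radius t = shell_radius t'" using shell_radius_bounds[of t] shell_radius_bounds[of t'] by auto
  then have "t = t'" by (metis shell_coord_radius)
  moreover have "d i = d' i" for i using fun_cong[OF x, of i] r shell_radius_bounds[of t'] by auto
  ultimately show ?thesis by auto
qed

lemma limitin_ray:
  assumes d: "direction d" and t: "t \<longlonglongrightarrow> l"
  shows "limitin M (\<lambda>k. ray d (t k)) (ray d l) sequentially"
proof -
  have "continuous_on UNIV shell_radius"
    unfolding shell_radius_def[abs_def] by (intro continuous_intros) (use add_pos_pos less_irrefl in \<open>metis exp_gt_zero zero_less_one\<close>)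
  then have "continuous_map euclideanreal euclideanreal shell_radius" by simp
  then have c: "continuous_map euclideanreal euclideanreal (\<lambda>t. v i + shell_radius t * d i)" for i
    by (intro continuous_map_add continuous_map_real_mult) auto
  have "(\<lambda>t i. v i + shell_radius t * d i) \<in> UNIV \<rightarrow> {x. \<forall>i\<ge>n. x i = 0}"
    using v_in_E d by (auto simp: topspace_Euclidean_space direction_def)
  then have "continuous_map euclideanreal E (\<lambda>t i. v i + shell_radius t * d i)"
    unfolding Euclidean_space_def continuous_map_in_subtopology
    using c by (simp add: continuous_map_componentwise_UNIV)
  then have "continuous_map euclideanreal (subtopology E V) (\<lambda>t i. v i + shell_radius t * d i)"
    by (rule continuous_map_into_subtopology) (use ray_chart(2)[OF d] in auto)
  from continuous_map_compose[OF this continuous_charts(2)]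
  have "continuous_map euclideanreal M (ray d)"
    by (simp add: o_def ray_def[abs_def] continuous_map_into_fulltopology)
  from continuous_map_limit[OF this, of t l sequentially] show ?thesis using t by (simp add: o_def)
qed

end

section \<open>Connecting orbits\<close>

text \<open>\<open>g'\<close> stands for the inverse of \<open>g\<close>. The condition
  \<open>g u \<noteq> u\<close> rules out constant orbits, by which every fixed point would be
  connected to itself. All ingredients are transported by conjugation.\<close>

definition connection :: "'a topology \<Rightarrow> ('a \<Rightarrow> 'a) \<Rightarrow> ('a \<Rightarrow> 'a) \<Rightarrow> 'a \<Rightarrow> 'a \<Rightarrow> bool" where
  "connection M g g' a b \<longleftrightarrow> (\<exists>u\<in>topspace M. g u \<noteq> u \<and>
     limitin M (\<lambda>k. (g ^^ k) u) b sequentially \<and> limitin M (\<lambda>k. (g' ^^ k) u) a sequentially)"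

lemma funpow_semiconj:
  assumes "g \<in> S \<rightarrow> S" "\<And>u. u \<in> S \<Longrightarrow> k (g u) = h (k u)" "u \<in> S"
  shows "(g ^^ j) u \<in> S \<and> (h ^^ j) (k u) = k ((g ^^ j) u)"
proof (induction j)
  case (Suc j)
  then have "(g ^^ j) u \<in> S" by blast
  then have "g ((g ^^ j) u) \<in> S" using assms(1) by blast
  then show ?case using Suc assms(2)[OF \<open>(g ^^ j) u \<in> S\<close>] by simp
qed (use assms in simp)

lemma connection_conj:
  assumes k: "continuous_map M M k" "inj_on k (topspace M)"
    and g: "g \<in> topspace M \<rightarrow> topspace M" "\<And>u. u \<in> topspace M \<Longrightarrow> k (g u) = h (k u)"
    and g': "g' \<in> topspace M \<rightarrow> topspace M" "\<And>u. u \<in> topspace M \<Longrightarrow> k (g' u) = h' (k u)"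
    and ab: "connection M g g' a b"
  shows "connection M h h' (k a) (k b)"
proof -
  obtain u where u: "u \<in> topspace M" "g u \<noteq> u" "limitin M (\<lambda>k. (g ^^ k) u) b sequentially"
    "limitin M (\<lambda>k. (g' ^^ k) u) a sequentially"
    using ab by (auto simp: connection_def)
  have "k u \<in> topspace M" using k(1) u(1) by (auto simp: continuous_map_def)
  moreover have "h (k u) \<noteq> k u"
    using g u inj_onD[OF k(2)] by (metis PiE Pi_mem)
  moreover have "limitin M (\<lambda>j. (h ^^ j) (k u)) (k b) sequentially"
    using continuous_map_limit[OF k(1) u(3)] funpow_semiconj[where k = k and h = h, OF g u(1)]
    by (simp add: o_def)
  moreover have "limitin M (\<lambda>j. (h' ^^ j) (k u)) (k a) sequentially"
    using continuous_map_limit[OF k(1) u(4)] funpow_semiconj[where k = k and h = h', OF g' u(1)]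
    by (simp add: o_def)
  ultimately show ?thesis unfolding connection_def by blast
qed

text \<open>A walk with steps of length 1 that changes direction is back at once where it was two
  steps earlier. Injectivity forbids this, so all steps are equal.\<close>

lemma unit_steps_inj:
  fixes J :: "int \<Rightarrow> int"
  assumes inj: "inj J" and step: "\<And>i. \<bar>J (i + 1) - J i\<bar> = 1"
  shows "(\<forall>i. J i = J 0 + i) \<or> (\<forall>i. J i = J 0 - i)"
proof -
  have same: "J (i + 1 + 1) - J (i + 1) = J (i + 1) - J i" for i
  proof (rule ccontr)
    assume "\<not> ?thesis"
    then have "J (i + 1 + 1) = J i" using step[of i] step[of "i + 1"] by linarith
    from injD[OF inj this] show False by simp
  qed
  have const: "J (i + 1) - J i = J 1 - J 0" for i
  proof (induction i rule: int_induct[where k = 0])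
    case base
    then show ?case by simp
  next
    case (step1 i)
    from same[of i] step1(2) show ?case by (rule trans)
  next
    case (step2 i)
    have "i - 1 + 1 = i" by simp
    with same[of "i - 1"] step2(2) show ?case by metis
  qed
  have "J i = J 0 + i * (J 1 - J 0)" for i
  proof (induction i rule: int_induct[where k = 0])
    case base
    then show ?case by simp
  next
    case (step1 i)
    then show ?case using const[of i] by (simp add: algebra_simps)
  next
    case (step2 i)
    have "i - 1 + 1 = i" by simp
    with const[of "i - 1"] have "J i - J (i - 1) = J 1 - J 0" by metis
    then show ?case using step2 by (simp add: algebra_simps)
  qed
  moreover have "J 1 - J 0 = 1 \<or> J 1 - J 0 = -1" using step[of 0] by (simp, linarith)
  ultimately show ?thesis by (metis add.inverse_inverse diff_conv_add_uminus mult.right_neutral mult_minus_right)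
qed

text \<open>The two values are mutually inverse, so the inverse flow has weights of the same
  kind.\<close>

definition two_valued :: "(int \<Rightarrow> real) \<Rightarrow> bool" where
  "two_valued c \<longleftrightarrow> (\<forall>i. c i = 2 \<or> c i = 1 / 2)"

lemma two_valued_pos: "two_valued c \<Longrightarrow> c i > 0"
  unfolding two_valued_def by (metis half_gt_zero_iff zero_less_numeral zero_less_one)

section \<open>The connections of the flows and their behaviour under conjugation\<close>

context charted_shell
begin

lemma shell_map_funpow_ray:
  "direction d \<Longrightarrow> (shell_map f ^^ k) (ray d t) = ray d ((f ^^ k) t)"
  by (induction k) (simp_all add: shell_map_ray)

abbreviation "flow c \<equiv> shell_map (line_flow c)"
abbreviation "back_flow c \<equiv> shell_map (line_flow (\<lambda>i. inverse (c i)))"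

lemma ray_in_M: "direction d \<Longrightarrow> ray d t \<in> topspace M"
  using ray_in_U U_subset by blast

lemma limits_on_ray:
  assumes c: "two_valued c" and d: "direction d" and t: "t \<notin> \<int>"
  defines "i \<equiv> \<lfloor>t\<rfloor>"
  shows "c i = 2 \<Longrightarrow> limitin M (\<lambda>k. (flow c ^^ k) (ray d t)) (ray d (of_int (i + 1))) sequentially"
    "c i = 2 \<Longrightarrow> limitin M (\<lambda>k. (back_flow c ^^ k) (ray d t)) (ray d (of_int i)) sequentially"
    "c i = 1 / 2 \<Longrightarrow> limitin M (\<lambda>k. (flow c ^^ k) (ray d t)) (ray d (of_int i)) sequentially"
    "c i = 1 / 2 \<Longrightarrow> limitin M (\<lambda>k. (back_flow c ^^ k) (ray d t)) (ray d (of_int (i + 1))) sequentially"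
proof -
  have p: "c j > 0" "inverse (c j) > 0" for j using two_valued_pos[OF c] by auto
  note l = line_flow_limits[of t c, OF t p(1)] line_flow_limits[of t "\<lambda>i. inverse (c i)", OF t p(2)]
  note r = limitin_ray[OF d]
  show "c i = 2 \<Longrightarrow> limitin M (\<lambda>k. (flow c ^^ k) (ray d t)) (ray d (of_int (i + 1))) sequentially"
    unfolding shell_map_funpow_ray[OF d] i_def by (rule r) (rule l(1))
  show "c i = 2 \<Longrightarrow> limitin M (\<lambda>k. (back_flow c ^^ k) (ray d t)) (ray d (of_int i)) sequentially"
    unfolding shell_map_funpow_ray[OF d] i_def by (rule r) (rule l(4), simp)
  show "c i = 1 / 2 \<Longrightarrow> limitin M (\<lambda>k. (flow c ^^ k) (ray d t)) (ray d (of_int i)) sequentially"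
    unfolding shell_map_funpow_ray[OF d] i_def by (rule r) (rule l(2))
  show "limitin M (\<lambda>k. (back_flow c ^^ k) (ray d t)) (ray d (of_int (i + 1))) sequentially"
    if "c i = 1 / 2"
  proof -
    have "inverse (c \<lfloor>t\<rfloor>) = 2" unfolding that[unfolded i_def] by simp
    then show ?thesis unfolding shell_map_funpow_ray[OF d] i_def by (intro r l(3))
  qed
qed

definition step_along_ray :: "(int \<Rightarrow> real) \<Rightarrow> (nat \<Rightarrow> real) \<Rightarrow> int \<Rightarrow> 'a \<Rightarrow> 'a \<Rightarrow> bool" where
  "step_along_ray c d i a b \<longleftrightarrow>
     c i = 2 \<and> a = ray d (of_int i) \<and> b = ray d (of_int (i + 1)) \<or>
     c i = 1 / 2 \<and> a = ray d (of_int (i + 1)) \<and> b = ray d (of_int i)"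

text \<open>The flow fixes every point off the rays and every integer point of a ray. A connecting
  orbit therefore stays over one open interval \<open>(i, i + 1)\<close>, and uniqueness of limits
  makes its ends the two endpoints, ordered by \<open>c i\<close>.\<close>

lemma connection_flow_iff:
  assumes c: "two_valued c"
  shows "connection M (flow c) (back_flow c) a b \<longleftrightarrow> (\<exists>d i. direction d \<and> step_along_ray c d i a b)"
proof
  assume "connection M (flow c) (back_flow c) a b"
  then obtain u where u: "u \<in> topspace M" "flow c u \<noteq> u"
    "limitin M (\<lambda>k. (flow c ^^ k) u) b sequentially"
    "limitin M (\<lambda>k. (back_flow c ^^ k) u) a sequentially"
    by (auto simp: connection_def)
  obtain d t where d: "direction d" and ut: "u = ray d t"
    using shell_map_cases[OF u(1)] u(2) by metis
  have t: "t \<notin> \<int>"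
  proof
    assume "t \<in> \<int>"
    then show False using u(2) shell_map_ray[OF d] by (auto simp: ut elim!: Ints_cases)
  qed
  have unique: "limitin M f l sequentially \<Longrightarrow> limitin M f l' sequentially \<Longrightarrow> l = l'"
    for f :: "nat \<Rightarrow> 'a" and l l'
    using limitin_Hausdorff_unique[OF _ _ _ Hausdorff] trivial_limit_sequentially by blast
  have "c \<lfloor>t\<rfloor> = 2 \<or> c \<lfloor>t\<rfloor> = 1 / 2" using c by (simp add: two_valued_def)
  then have "step_along_ray c d \<lfloor>t\<rfloor> a b"
    using limits_on_ray[OF c d t] u(3,4) unique unfolding step_along_ray_def ut by metis
  then show "\<exists>d i. direction d \<and> step_along_ray c d i a b" using d by blast
next
  assume "\<exists>d i. direction d \<and> step_along_ray c d i a b"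
  then obtain d i where d: "direction d" and ab: "step_along_ray c d i a b" by blast
  \<comment> \<open>The midpoint serves as a sample non-fixed point of the interval.\<close>
  define t where "t = real_of_int i + 1 / 2"
  have fl: "\<lfloor>t\<rfloor> = i" unfolding t_def by linarith
  have t: "t \<notin> \<int>"
  proof
    assume "t \<in> \<int>"
    then have "t = of_int i" using fl by (metis Ints_cases floor_of_int)
    then show False by (simp add: t_def)
  qed
  have "flow c (ray d t) \<noteq> ray d t"
  proof
    assume "flow c (ray d t) = ray d t"
    then have "line_flow c t = t" using shell_map_ray[OF d] ray_inj[OF d d] by metis
    then have stay: "(line_flow c ^^ k) t = t" for k by (induction k) simp_all
    have "c i = 2 \<or> c i = 1 / 2" using c by (simp add: two_valued_def)
    then have "t = of_int (i + 1) \<or> t = of_int i"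
      using line_flow_limits[of t c, OF t two_valued_pos[OF c]] LIMSEQ_const_iff unfolding fl stay by blast
    then show False using t by (metis Ints_of_int)
  qed
  moreover have "limitin M (\<lambda>k. (flow c ^^ k) (ray d t)) b sequentially"
    "limitin M (\<lambda>k. (back_flow c ^^ k) (ray d t)) a sequentially"
    using ab limits_on_ray[OF c d t] unfolding fl step_along_ray_def by blast+
  ultimately show "connection M (flow c) (back_flow c) a b"
    unfolding connection_def using ray_in_M[OF d] by blast
qed

text \<open>
  The connections of \<^term>\<open>flow c\<close> make up one copy, for each direction, of the integer line with
  edges oriented by \<^term>\<open>c\<close>.  A conjugation maps these lines onto one another.
\<close>

lemma conjugate_flows:
  assumes c: "two_valued c" and c': "two_valued c'"
    and k: "continuous_map M M k" "inj_on k (topspace M)"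
    and conj: "\<And>u. u \<in> topspace M \<Longrightarrow> k (flow c u) = flow c' (k u)"
  shows "(\<exists>s. \<forall>i. c' (s + i) = c i) \<or> (\<exists>s. \<forall>i. c' (s - i) = inverse (c i))"
proof -
  have kM: "k u \<in> topspace M" if "u \<in> topspace M" for u using k(1) that by (auto simp: continuous_map_def)
  have conj': "k (back_flow c u) = back_flow c' (k u)" if "u \<in> topspace M" for u
  proof -
    have "flow c (back_flow c u) = u"
      using line_flow_inverse(1)[of c, OF two_valued_pos[OF c]] that by (simp add: shell_map_compose shell_map_id)
    then have "back_flow c' (k u) = back_flow c' (flow c' (k (back_flow c u)))"
      using conj[of "back_flow c u"] shell_map_in_M[OF that] by simp
    also have "\<dots> = k (back_flow c u)"
      using line_flow_inverse(2)[of c', OF two_valued_pos[OF c']] kM[OF shell_map_in_M[OF that]]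
      by (simp add: shell_map_compose shell_map_id)
    finally show ?thesis ..
  qed
  have conn: "\<exists>d i. direction d \<and> step_along_ray c' d i (k a) (k b)"
    if "direction d" "step_along_ray c d i a b" for a b d i
  proof -
    have "connection M (flow c) (back_flow c) a b"
      unfolding connection_flow_iff[OF c] using that by blast
    moreover have "shell_map f \<in> topspace M \<rightarrow> topspace M" for f using shell_map_in_M by blast
    ultimately have "connection M (flow c') (back_flow c') (k a) (k b)"
      using connection_conj[where h = "flow c'" and h' = "back_flow c'", OF k _ conj _ conj'] by blast
    then show ?thesis unfolding connection_flow_iff[OF c'] .
  qed
  obtain d0 where d0: "direction d0" using direction_exists by blast
  let ?a = "\<lambda>i :: int. ray d0 (of_int i)"
  have cv: "c i = 2 \<or> c i = 1 / 2" for i using c by (simp add: two_valued_def)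
  have edge: "\<exists>d j. direction d \<and> (c i = 2 \<and> step_along_ray c' d j (k (?a i)) (k (?a (i + 1))) \<or>
      c i = 1 / 2 \<and> step_along_ray c' d j (k (?a (i + 1))) (k (?a i)))" for i
  proof (cases "c i = 2")
    case True
    then have "step_along_ray c d0 i (?a i) (?a (i + 1))" by (simp add: step_along_ray_def)
    from conn[OF d0 this] show ?thesis using True by blast
  next
    case False
    then have "c i = 1 / 2" using cv by blast
    then have "step_along_ray c d0 i (?a (i + 1)) (?a i)" by (simp add: step_along_ray_def)
    from conn[OF d0 this] show ?thesis using \<open>c i = 1 / 2\<close> by blast
  qed
  have "\<exists>d j. direction d \<and> k (?a i) = ray d (of_int j)" for i :: int
    using edge[of i] unfolding step_along_ray_def by metis
  then obtain \<delta> J where \<delta>J: "\<And>i. direction (\<delta> i)" "\<And>i. k (?a i) = ray (\<delta> i) (of_int (J i))" by metis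
  have ray_eq: "d = \<delta> i \<and> j = J i" if "direction d" "ray d (of_int j) = k (?a i)" for d i and j :: int
    using ray_inj[OF that(1) \<delta>J(1)[of i], of "of_int j" "of_int (J i)"] that(2) \<delta>J(2) by simp
  \<comment> \<open>Rays in distinct directions are disjoint, so both ends of an image edge
    determine the same direction. An edge is numbered by its lower end: traversed downwards from
    \<open>J i\<close>, it has number \<open>J i - 1\<close> and the inverse weight.\<close>
  have step: "\<delta> (i + 1) = \<delta> i \<and> (J (i + 1) = J i + 1 \<and> c' (J i) = c i \<or>
      J (i + 1) = J i - 1 \<and> c' (J i - 1) = inverse (c i))" for i
  proof -
    obtain d j where d: "direction d" and "c i = 2 \<and> step_along_ray c' d j (k (?a i)) (k (?a (i + 1))) \<or>
      c i = 1 / 2 \<and> step_along_ray c' d j (k (?a (i + 1))) (k (?a i))"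
      using edge by blast
    then consider
        "k (?a i) = ray d (of_int j)" "k (?a (i + 1)) = ray d (of_int (j + 1))" "c' j = c i"
      | "k (?a i) = ray d (of_int (j + 1))" "k (?a (i + 1)) = ray d (of_int j)" "c' j = inverse (c i)"
    proof -
      have "c i = 2 \<Longrightarrow> c' j = 2 \<Longrightarrow> c' j = c i" "c i = 1 / 2 \<Longrightarrow> c' j = 1 / 2 \<Longrightarrow> c' j = c i"
        "c i = 2 \<Longrightarrow> c' j = 1 / 2 \<Longrightarrow> c' j = inverse (c i)" "c i = 1 / 2 \<Longrightarrow> c' j = 2 \<Longrightarrow> c' j = inverse (c i)"
        by (simp_all only: inverse_divide div_by_1 inverse_eq_divide[of 2])
      then show thesis
        using that \<open>c i = 2 \<and> _ \<or> _\<close> unfolding step_along_ray_def by blast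
    qed
    then show ?thesis
    proof cases
      case 1
      then show ?thesis using ray_eq[OF d, of j i] ray_eq[OF d, of "j + 1" "i + 1"] by auto
    next
      case 2
      have "d = \<delta> i" "J i = j + 1" using ray_eq[OF d, of "j + 1" i] 2(1) by metis+
      moreover have "d = \<delta> (i + 1)" "J (i + 1) = j" using ray_eq[OF d, of j "i + 1"] 2(2) by metis+
      ultimately show ?thesis using 2(3) by simp
    qed
  qed
  have \<delta>: "\<delta> i = \<delta> 0" for i
  proof (induction i rule: int_induct[where k = 0])
    case (step1 i)
    then show ?case using step[of i] by simp
  next
    case (step2 i)
    then show ?case using step[of "i - 1"] by simp
  qed simp
  have "inj J"
  proof (rule injI)
    fix i j assume "J i = J j"
    then have "k (?a i) = k (?a j)" using \<delta>J(2) \<delta> by metis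
    then have "?a i = ?a j" using inj_onD[OF k(2)] ray_in_M[OF d0] by blast
    then show "i = j" using ray_inj[OF d0 d0] by (metis of_int_eq_iff)
  qed
  moreover have "\<bar>J (i + 1) - J i\<bar> = 1" for i using step[of i] by linarith
  ultimately consider "\<forall>i. J i = J 0 + i" | "\<forall>i. J i = J 0 - i" using unit_steps_inj by blast
  then show ?thesis
  proof cases
    case 1
    have "c' (J 0 + i) = c i" for i
    proof -
      have J: "J i = J 0 + i" "J (i + 1) = J 0 + (i + 1)" using 1 by blast+
      then have "J (i + 1) \<noteq> J i - 1" by linarith
      then have "c' (J i) = c i" using step[of i] by blast
      then show ?thesis unfolding J(1) .
    qed
    then show ?thesis by blast
  next
    case 2
    \<comment> \<open>The extra 1 comes from numbering a descending edge by its lower end.\<close>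
    have "c' (J 0 - 1 - i) = inverse (c i)" for i
    proof -
      have J: "J i = J 0 - i" "J (i + 1) = J 0 - (i + 1)" using 2 by blast+
      then have "J (i + 1) \<noteq> J i + 1" by linarith
      then have "c' (J i - 1) = inverse (c i)" using step[of i] by blast
      moreover have "J i - 1 = J 0 - 1 - i" using J(1) by linarith
      ultimately show ?thesis by metis
    qed
    then show ?thesis by blast
  qed
qed

lemma flow_in_Homeo: "two_valued c \<Longrightarrow> flow c \<in> carrier (Homeo M)"
  by (rule shell_map_in_Homeo[OF line_flow_in_line_homeos[OF two_valued_pos]])

lemma conjugate_in_flows:
  assumes c: "two_valued c" and c': "two_valued c'"
    and conj: "conjugate_in (Homeo M) (flow c) (flow c')"
  shows "(\<exists>s. \<forall>i. c' (s + i) = c i) \<or> (\<exists>s. \<forall>i. c' (s - i) = inverse (c i))"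
proof -
  interpret G: group "Homeo M" by (rule group_Homeo)
  note f = flow_in_Homeo[OF c] flow_in_Homeo[OF c']
  obtain k where k: "k \<in> carrier (Homeo M)" "flow c' = k \<otimes>\<^bsub>Homeo M\<^esub> flow c \<otimes>\<^bsub>Homeo M\<^esub> inv\<^bsub>Homeo M\<^esub> k"
    using conj by (auto simp: conjugate_in_def)
  then have "flow c' \<otimes>\<^bsub>Homeo M\<^esub> k = k \<otimes>\<^bsub>Homeo M\<^esub> flow c"
    using f by (simp add: G.m_assoc)
  then have "compose (topspace M) (flow c') k = compose (topspace M) k (flow c)"
    using k f by (simp add: mult_Homeo)
  then have "k (flow c u) = flow c' (k u)" if "u \<in> topspace M" for u
    using that by (metis compose_eq)
  moreover have "inj_on k (topspace M)"
    using k(1) by (simp add: carrier_Homeo homeomorphic_eq_everything_map)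
  ultimately show ?thesis by (intro conjugate_flows[OF c c' continuous_Homeo[OF k(1)]])
qed

text \<open>At each point only one weight matters, so a condition on a flow splits into countably
  many conditions on single weights; this makes the family Borel in its parameter. Off the rays the
  value is arbitrary, as all shell maps agree there.\<close>

definition ray_index :: "'a \<Rightarrow> int" where
  "ray_index p = (SOME i. \<exists>d t. direction d \<and> p = ray d t \<and> i = \<lfloor>t\<rfloor>)"

lemma flow_eq_constant_flow:
  assumes "p \<in> topspace M"
  shows "flow c p = flow (\<lambda>_. c (ray_index p)) p"
  using assms
proof (cases rule: shell_map_cases)
  case (1 d t)
  then have "\<exists>i d t. direction d \<and> p = ray d t \<and> i = \<lfloor>t\<rfloor>" by blast
  from someI_ex[OF this] obtain d' t' where "direction d'" "p = ray d' t'" "ray_index p = \<lfloor>t'\<rfloor>"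
    unfolding ray_index_def by blast
  then have "ray_index p = \<lfloor>t\<rfloor>" using 1 ray_inj by blast
  then show ?thesis using 1 shell_map_ray by (simp add: line_flow_def)
qed simp

text \<open>The conjugator is the unit translation along all rays at once.\<close>

lemma conjugate_in_shifted_flow:
  assumes c: "two_valued c"
  shows "conjugate_in (Homeo M) (flow (\<lambda>i. c (i + 1))) (flow c)"
proof -
  interpret G: group "Homeo M" by (rule group_Homeo)
  let ?c = "\<lambda>i. c (i + 1)"
  have c': "two_valued ?c" using c by (simp add: two_valued_def)
  note f = flow_in_Homeo[OF c] flow_in_Homeo[OF c'] shell_map_in_Homeo[OF translation_in_line_homeos]
  have "(\<lambda>t. t + 1) \<circ> line_flow ?c = line_flow c \<circ> (\<lambda>t. t + 1)"
    using line_flow_shift[of c] by auto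
  then have "shell_map (\<lambda>t. t + 1) (flow ?c p) = flow c (shell_map (\<lambda>t. t + 1) p)" if "p \<in> topspace M" for p
    using that by (simp add: shell_map_compose)
  then have "compose (topspace M) (shell_map (\<lambda>t. t + 1)) (flow ?c) = compose (topspace M) (flow c) (shell_map (\<lambda>t. t + 1))"
    by (auto simp: compose_def fun_eq_iff)
  then have "shell_map (\<lambda>t. t + 1) \<otimes>\<^bsub>Homeo M\<^esub> flow ?c = flow c \<otimes>\<^bsub>Homeo M\<^esub> shell_map (\<lambda>t. t + 1)"
    using f by (simp add: mult_Homeo)
  then have "flow c = shell_map (\<lambda>t. t + 1) \<otimes>\<^bsub>Homeo M\<^esub> flow ?c \<otimes>\<^bsub>Homeo M\<^esub> inv\<^bsub>Homeo M\<^esub> (shell_map (\<lambda>t. t + 1))"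
    using f by (simp add: G.m_assoc)
  then show ?thesis using f(3) unfolding conjugate_in_def by blast
qed

text \<open>The image of the ball of radius 2 is compact and contains an open ball around the
  centre. Local compactness of a manifold comes from here.\<close>

lemma compact_neighbourhood:
  "\<exists>W C. openin M W \<and> compactin M C \<and> \<psi>' v \<in> W \<and> W \<subseteq> C"
proof -
  let ?B = "{x \<in> topspace E. N x \<le> 2}"
  have "compactin E ?B" by (rule compactin_shell_norm_ball[OF K_pos])
  then have "compactin (subtopology E V) ?B" using ball_in_V by (auto simp: compactin_subtopology)
  then have "compactin (subtopology M U) (\<psi>' ` ?B)" by (rule image_compactin[OF _ continuous_charts(2)])
  then have C: "compactin M (\<psi>' ` ?B)" by (simp add: compactin_subtopology)
  have "continuous_map (subtopology E V) euclideanreal N"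
    unfolding Euclidean_space_def
    by (intro continuous_map_from_subtopology continuous_map_shell_norm)
  from continuous_map_compose[OF continuous_charts(1) this]
  have "continuous_map (subtopology M U) euclideanreal (\<lambda>p. N (\<psi> p))" by (simp add: o_def)
  then have "openin (subtopology M U) {p \<in> topspace (subtopology M U). N (\<psi> p) \<in> {..<2}}"
    by (rule openin_continuous_map_preimage) simp
  then have W: "openin M {p \<in> U. N (\<psi> p) < 2}"
    using U_subset open_U by (simp add: openin_open_subtopology Int_absorb1)
  have "{p \<in> U. N (\<psi> p) < 2} \<subseteq> \<psi>' ` ?B"
  proof
    fix p assume p: "p \<in> {p \<in> U. N (\<psi> p) < 2}"
    then have "\<psi> p \<in> ?B" using chart_simps(1) V_subset by auto
    then have "\<psi>' (\<psi> p) \<in> \<psi>' ` ?B" by (rule imageI)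
    then show "p \<in> \<psi>' ` ?B" using p chart_simps(2) by simp
  qed
  moreover have "\<psi>' v \<in> {p \<in> U. N (\<psi> p) < 2}"
    using chart_simps(3,4)[OF v_in_V] by (simp add: shell_norm_def)
  ultimately show ?thesis using W C by blast
qed

end

section \<open>Charts and a countable base of a manifold\<close>

lemma manifold_nonempty: "manifold M \<Longrightarrow> \<exists>p. p \<in> topspace M"
  unfolding manifold_def by blast

lemma manifold_charted_shell:
  assumes M: "manifold M" and p: "p \<in> topspace M"
  obtains U n V \<psi> \<psi>' v K where "charted_shell M U n V \<psi> \<psi>' v K" "\<psi>' v = p"
proof -
  obtain n U V where n: "n > 0" and U: "openin M U" "p \<in> U" and V: "openin (Euclidean_space n) V"
    and hs: "subtopology M U homeomorphic_space subtopology (Euclidean_space n) V"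
    using M p unfolding manifold_def by metis
  then obtain \<psi> \<psi>' where \<psi>: "homeomorphic_maps (subtopology M U) (subtopology (Euclidean_space n) V) \<psi> \<psi>'"
    unfolding homeomorphic_space_def by blast
  have "p \<in> topspace (subtopology M U)" using U p by simp
  then have v: "\<psi> p \<in> V" "\<psi>' (\<psi> p) = p"
    using \<psi> by (auto simp: homeomorphic_maps_def continuous_map_def Pi_iff)
  obtain K where K: "K > 0"
    "\<And>x. x \<in> topspace (Euclidean_space n) \<Longrightarrow> shell_norm n (\<psi> p) K x \<le> 2 \<Longrightarrow> x \<in> V"
    using shell_norm_ball_in_open[OF V v(1)] by blast
  have "charted_shell M U n V \<psi> \<psi>' (\<psi> p) K"
    using M n U V \<psi> v K by unfold_locales (auto simp: manifold_def)
  then show thesis using that v(2) by blast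
qed

lemma manifold_based_space:
  assumes M: "manifold M"
  obtains B where "based_space M B"
proof -
  obtain \<B> where \<B>: "countable \<B>" "\<And>V. V \<in> \<B> \<Longrightarrow> openin M V"
    "\<And>U p. openin M U \<Longrightarrow> p \<in> U \<Longrightarrow> \<exists>V\<in>\<B>. p \<in> V \<and> V \<subseteq> U"
    using M unfolding manifold_def second_countable_def by metis
  obtain p where "p \<in> topspace M" using manifold_nonempty[OF M] by blast
  then have ne: "\<B> \<noteq> {}" using \<B>(3)[OF openin_topspace] by blast
  have "locally_compact_space M"
    unfolding locally_compact_space_def
  proof
    fix p assume "p \<in> topspace M"
    then obtain U n V \<psi> \<psi>' v K where "charted_shell M U n V \<psi> \<psi>' v K" "\<psi>' v = p"
      by (rule manifold_charted_shell[OF M])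
    from charted_shell.compact_neighbourhood[OF this(1)] this(2)
    show "\<exists>U K. openin M U \<and> compactin M K \<and> p \<in> U \<and> U \<subseteq> K" by simp
  qed
  moreover have "\<exists>n. p \<in> from_nat_into \<B> n \<and> from_nat_into \<B> n \<subseteq> U" if "openin M U" "p \<in> U" for U p
    using \<B>(3)[OF that] from_nat_into_surj[OF \<B>(1)] by metis
  moreover have "Hausdorff_space M" using M by (simp add: manifold_def)
  ultimately have "based_space M (from_nat_into \<B>)"
    using \<B>(2)[OF from_nat_into[OF ne]] by unfold_locales
  then show thesis by (rule that)
qed

section \<open>Weights given by an irrational rotation\<close>

text \<open>The symbolic coding of the orbit of \<open>x\<close> under the rotation of the circle by
  \<open>\<theta>\<close>, with respect to the two half circles.\<close>

definition rotation_weights :: "real \<Rightarrow> real \<Rightarrow> int \<Rightarrow> real" where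
  "rotation_weights \<theta> x i = (if frac (x + of_int i * \<theta>) < 1 / 2 then 2 else 1 / 2)"

lemma two_valued_rotation_weights: "two_valued (rotation_weights \<theta> x)"
  by (simp add: two_valued_def rotation_weights_def)

lemma rotation_weights_add_1: "rotation_weights \<theta> (x + 1) = rotation_weights \<theta> x"
proof -
  have "frac (x + 1 + of_int i * \<theta>) = frac (x + of_int i * \<theta>)" for i
    using frac_1_eq[of "x + of_int i * \<theta>"] by (simp add: algebra_simps)
  then show ?thesis by (simp add: rotation_weights_def fun_eq_iff)
qed

lemma rotation_weights_add_angle: "rotation_weights \<theta> (x + \<theta>) = (\<lambda>i. rotation_weights \<theta> x (i + 1))"
  by (simp add: rotation_weights_def fun_eq_iff algebra_simps)

text \<open>Some rotation carries the midpoint of \<open>x\<close> and \<open>y\<close> to within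
  \<open>(y - x) / 4\<close> of 1/2 modulo 1, so the two points land on opposite sides of 1/2. Their
  distance below 1/4 keeps both inside \<open>(0, 1)\<close>.\<close>

lemma rotation_weights_inj:
  assumes "\<theta> \<notin> \<rat>"
  shows "inj_on (rotation_weights \<theta>) {0<..<1 / 4}"
proof (rule linorder_inj_onI)
  fix x y :: real assume xy: "x < y" "x \<in> {0<..<1 / 4}" "y \<in> {0<..<1 / 4}"
  have "(y - x) / 4 > 0" using xy by simp
  then obtain h k :: int where hk: "\<bar>of_int k * \<theta> - of_int h - (1 / 2 - (x + y) / 2)\<bar> < (y - x) / 4"
    by (rule sequence_of_fractional_parts_is_dense[OF assms])
  have fr: "frac (z + of_int k * \<theta>) = z + of_int k * \<theta> - of_int h"
    if "0 \<le> z + of_int k * \<theta> - of_int h" "z + of_int k * \<theta> - of_int h < 1" for z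
    using that by (simp add: frac_unique_iff)
  have b: "0 < x + of_int k * \<theta> - of_int h" "x + of_int k * \<theta> - of_int h < 1 / 2"
    "1 / 2 < y + of_int k * \<theta> - of_int h" "y + of_int k * \<theta> - of_int h < 1"
    using hk xy by (auto simp: abs_if field_simps split: if_splits)
  then have "rotation_weights \<theta> x k \<noteq> rotation_weights \<theta> y k"
    using fr[of x] fr[of y] by (simp add: rotation_weights_def)
  then show "rotation_weights \<theta> x \<noteq> rotation_weights \<theta> y" by metis
qed auto

text \<open>A countable union over the integer part \<open>k\<close>; the lower bound is written as
  a negated strict inequality, so that all conditions are open or complements of open ones.\<close>

lemma Borel_sets_frac_less: "{x. frac (x + c) < b} \<in> Borel_sets_in euclideanreal"
proof -
  have open_less: "{x \<in> topspace euclideanreal. x + c < a} \<in> Borel_sets_in euclideanreal" for a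
    by (rule Borel_sets_in_open) (simp add: open_Collect_less continuous_intros)
  have "{x \<in> topspace euclideanreal. \<exists>k :: int. \<not> x + c < of_int k \<and> x + c < of_int k + 1 \<and> x + c < of_int k + b}
      \<in> Borel_sets_in euclideanreal"
    by (intro Borel_sets_in.sets_Collect_countable_Ex Borel_sets_in.sets_Collect_conj
        Borel_sets_in.sets_Collect_neg open_less)
  moreover have "frac (x + c) < b \<longleftrightarrow>
      (\<exists>k :: int. \<not> x + c < of_int k \<and> x + c < of_int k + 1 \<and> x + c < of_int k + b)" for x
  proof
    assume "frac (x + c) < b"
    then show "\<exists>k :: int. \<not> x + c < of_int k \<and> x + c < of_int k + 1 \<and> x + c < of_int k + b"
      by (intro exI[of _ "\<lfloor>x + c\<rfloor>"]) (unfold frac_def, linarith)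
  next
    assume "\<exists>k :: int. \<not> x + c < of_int k \<and> x + c < of_int k + 1 \<and> x + c < of_int k + b"
    then obtain k :: int where k: "\<not> x + c < of_int k" "x + c < of_int k + 1" "x + c < of_int k + b" by blast
    then have "\<lfloor>x + c\<rfloor> = k" by linarith
    then show "frac (x + c) < b" using k by (simp add: frac_def)
  qed
  ultimately show ?thesis by simp
qed

section \<open>Countability of the language, and invariance of types under conjugation\<close>

instance grp_term :: countable
  by countable_datatype

instance grp_formula :: countable
  by countable_datatype

text \<open>Conjugation by \<open>k\<close> is an automorphism taking \<open>g\<close> to
  \<open>h\<close>, and automorphisms preserve satisfaction.\<close>

lemma sat_conjugate:
  assumes "group G" "g \<in> carrier G" "conjugate_in G g h"
  shows "sat G (\<lambda>_. h) \<psi> \<longleftrightarrow> sat G (\<lambda>_. g) \<psi>"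
proof -
  interpret group G by fact
  obtain k where k: "k \<in> carrier G" "h = k \<otimes>\<^bsub>G\<^esub> g \<otimes>\<^bsub>G\<^esub> inv\<^bsub>G\<^esub> k"
    using assms(3) by (auto simp: conjugate_in_def)
  let ?c = "\<lambda>a. k \<otimes>\<^bsub>G\<^esub> a \<otimes>\<^bsub>G\<^esub> inv\<^bsub>G\<^esub> k"
  have "sat G (?c \<circ> (\<lambda>_. g)) \<psi> \<longleftrightarrow> sat G (\<lambda>_. g) \<psi>"
  proof (rule sat_iso_image)
    show "inj_on ?c (carrier G)" using k(1) by (auto simp: inj_on_def)
    show "?c ` carrier G = carrier G"
    proof
      show "?c ` carrier G \<subseteq> carrier G" using k(1) by auto
      show "carrier G \<subseteq> ?c ` carrier G"
      proof
        fix a assume a: "a \<in> carrier G"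
        have "k \<otimes>\<^bsub>G\<^esub> (inv\<^bsub>G\<^esub> k \<otimes>\<^bsub>G\<^esub> a) = a" using k(1) a by (simp add: m_assoc[symmetric])
        then have "a = ?c (inv\<^bsub>G\<^esub> k \<otimes>\<^bsub>G\<^esub> a \<otimes>\<^bsub>G\<^esub> k)" using k(1) a by (simp add: m_assoc)
        then show "a \<in> ?c ` carrier G" by (rule image_eqI) (use k(1) a in simp)
      qed
    qed
    show "?c (a \<otimes>\<^bsub>G\<^esub> b) = ?c a \<otimes>\<^bsub>G\<^esub> ?c b" if "a \<in> carrier G" "b \<in> carrier G" for a b
    proof -
      have "inv\<^bsub>G\<^esub> k \<otimes>\<^bsub>G\<^esub> (k \<otimes>\<^bsub>G\<^esub> x) = x" if "x \<in> carrier G" for x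
        using k(1) that by (simp add: m_assoc[symmetric])
      then show ?thesis using k(1) that by (simp add: m_assoc)
    qed
  qed (use k(1) assms(2) in auto)
  then show ?thesis by (simp add: o_def k(2))
qed

theorem theorem1p7:
  fixes M :: "'a topology"
  assumes PBP
    and "manifold M"
  shows "\<exists>g\<in>carrier (Homeo M). \<exists>h\<in>carrier (Homeo M).
           tp (Homeo M) g = tp (Homeo M) h \<and> \<not> conjugate_in (Homeo M) g h"
proof -
  obtain p where "p \<in> topspace M" using manifold_nonempty[OF \<open>manifold M\<close>] by blast
  then obtain U n V \<psi> \<psi>' v K where "charted_shell M U n V \<psi> \<psi>' v K"
    by (rule manifold_charted_shell[OF \<open>manifold M\<close>])
  then interpret charted_shell M U n V \<psi> \<psi>' v K .
  obtain B where "based_space M B" by (rule manifold_based_space[OF \<open>manifold M\<close>])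
  then interpret base: based_space M B .
  obtain \<theta> :: real where \<theta>: "\<theta> \<notin> \<rat>"
    using countable_rat uncountable_UNIV_real by (metis UNIV_eq_I)
  define g where "g x = flow (rotation_weights \<theta> x)" for x
  have g: "g x \<in> carrier (Homeo M)" for x
    unfolding g_def by (rule flow_in_Homeo[OF two_valued_rotation_weights])
  define A where "A \<phi> = {x. sat (Homeo M) (\<lambda>_. g x) \<phi>}" for \<phi>
  have Borel: "{x \<in> topspace euclideanreal. g x ` B m \<subseteq> B n'} \<in> Borel_sets_in euclideanreal" for m n'
  proof -
    let ?S = "\<lambda>i :: int. {x. frac (x + of_int i * \<theta>) < 1 / 2}"
    \<comment> \<open>\<open>?Q\<close> quantifies over possibly uncountably many points, but it
      does not depend on \<open>x\<close>. The parameter only decides, through \<open>?S i\<close>,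
      which of \<open>?Q i 2\<close> and \<open>?Q i (1 / 2)\<close> is required.\<close>
    let ?Q = "\<lambda>i a. \<forall>p\<in>B m. ray_index p = i \<longrightarrow> flow (\<lambda>_. a) p \<in> B n'"
    have "g x ` B m \<subseteq> B n' \<longleftrightarrow> (\<forall>i. (x \<in> ?S i \<longrightarrow> ?Q i 2) \<and> (x \<notin> ?S i \<longrightarrow> ?Q i (1 / 2)))" for x
    proof -
      have "g x p = flow (\<lambda>_. rotation_weights \<theta> x (ray_index p)) p" if "p \<in> B m" for p
        unfolding g_def by (rule flow_eq_constant_flow) (use that base.base_subset_topspace in blast)
      then have "g x ` B m \<subseteq> B n' \<longleftrightarrow> (\<forall>i. ?Q i (rotation_weights \<theta> x i))" by auto
      then show ?thesis by (simp add: rotation_weights_def)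
    qed
    moreover have S: "{x \<in> topspace euclideanreal. x \<in> ?S i} \<in> Borel_sets_in euclideanreal" for i
      by (simp only: topspace_euclidean UNIV_I simp_thms mem_Collect_eq Borel_sets_frac_less)
    have "{x \<in> topspace euclideanreal. \<forall>i. (x \<in> ?S i \<longrightarrow> ?Q i 2) \<and> (x \<notin> ?S i \<longrightarrow> ?Q i (1 / 2))}
        \<in> Borel_sets_in euclideanreal"
      by (intro Borel_sets_in.sets_Collect_countable_All Borel_sets_in.sets_Collect_conj
          Borel_sets_in.sets_Collect_imp Borel_sets_in.sets_Collect_neg Borel_sets_in.sets_Collect_const S)
    ultimately show ?thesis by simp
  qed
  have BP: "has_Baire_property euclideanreal (A \<phi>)" for \<phi>
    using base.projective_in_sat_Homeo[of euclideanreal g \<phi>, OF g Borel] \<open>PBP\<close>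
    by (simp add: PBP_def A_def)
  have conj: "conjugate_in (Homeo M) (g (x + \<theta>)) (g x)" for x
    unfolding g_def rotation_weights_add_angle
    by (rule conjugate_in_shifted_flow[OF two_valued_rotation_weights])
  have inv: "x + 1 \<in> A \<phi> \<longleftrightarrow> x \<in> A \<phi>" "x + \<theta> \<in> A \<phi> \<longleftrightarrow> x \<in> A \<phi>" for x \<phi>
    using sat_conjugate[OF group_Homeo g conj] by (simp_all add: A_def g_def rotation_weights_add_1)
  have "countable (UNIV :: grp_formula set)" by simp
  then obtain C where C: "meager_in euclideanreal (- C)"
    "\<And>\<phi> x y. \<phi> \<in> UNIV \<Longrightarrow> x \<in> C \<Longrightarrow> y \<in> C \<Longrightarrow> x \<in> A \<phi> \<longleftrightarrow> y \<in> A \<phi>"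
    by (rule countable_types_constant_on_comeager[where A = A, OF _ \<theta> BP inv]) blast
  obtain x where x: "x \<in> C"
  proof (rule ccontr)
    assume "\<not> thesis"
    then have "{0<..<1} \<subseteq> - C" using that by auto
    then show False using not_meager_real_interval[of 0 1] meager_in_subset[OF C(1)] by simp
  qed
  \<comment> \<open>On this interval distinct parameters have distinct weight sequences, so
    \<open>S\<close> is at most as large as its set of weight sequences.\<close>
  define S where "S = {y \<in> {0<..<1 / 4}. conjugate_in (Homeo M) (g x) (g y)}"
  let ?w = "rotation_weights \<theta>"
  \<comment> \<open>All shifts of the weights of \<open>x\<close>, and all their reflections with
    inverted weights; \<open>s\<close> is an integer, so the set is countable.\<close>
  let ?R = "range (\<lambda>s i. ?w x (i - s)) \<union> range (\<lambda>s i. inverse (?w x (s - i)))"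
  have "?w y \<in> ?R" if "y \<in> S" for y
  proof -
    have "conjugate_in (Homeo M) (flow (?w x)) (flow (?w y))" using that by (simp add: S_def g_def)
    from conjugate_in_flows[OF two_valued_rotation_weights two_valued_rotation_weights this]
    consider s where "\<forall>i. ?w y (s + i) = ?w x i" | s where "\<forall>i. ?w y (s - i) = inverse (?w x i)"
      by blast
    then show ?thesis
    proof cases
      case 1
      have "?w y j = ?w x (j - s)" for j using 1[THEN spec[of _ "j - s"]] by simp
      then have "?w y = (\<lambda>i. ?w x (i - s))" by (rule ext)
      then show ?thesis by blast
    next
      case 2
      have "?w y j = inverse (?w x (s - j))" for j using 2[THEN spec[of _ "s - j"]] by simp
      then have "?w y = (\<lambda>i. inverse (?w x (s - i)))" by (rule ext)
      then show ?thesis by blast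
    qed
  qed
  then have "?w ` S \<subseteq> ?R" by blast
  then have "countable (?w ` S)" by (rule countable_subset) simp
  moreover have "inj_on ?w S"
    using rotation_weights_inj[OF \<theta>] by (rule inj_on_subset) (auto simp: S_def)
  ultimately have "countable S" by (rule countable_image_inj_on)
  \<comment> \<open>Removing the countable set \<open>S\<close> leaves \<open>C\<close> comeager, so
    by Baire category some \<open>y\<close> of the interval survives.\<close>
  then have "meager_in euclideanreal (- C \<union> S)"
    by (intro meager_in_Un C(1) countable_imp_meager_real)
  then have "\<not> {0<..<1 / 4} \<subseteq> - C \<union> S"
    using not_meager_real_interval[of 0 "1 / 4"] meager_in_subset by fastforce
  then obtain y where y: "y \<in> C" "\<not> conjugate_in (Homeo M) (g x) (g y)"
    by (auto simp: S_def)
  have "tp (Homeo M) (g x) = tp (Homeo M) (g y)"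
    using C(2)[OF UNIV_I x y(1)] by (auto simp: tp_def A_def)
  then show ?thesis using g y(2) by blast
qed

end
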